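(* Let $N\ge 2$, $\xi>0$, and consider the system of $N$ agents in the plane with $n=1$ (each agent interacts only with its single closest neighbor, with isotropic attraction and repulsion), i.e. $\dot x(t)=f(x(t))$ with $f$ as defined in the context. Then for any initial condition $x^0\in(\mathbb{R}^2)^N\setminus S$, this equation has at least one Filippov solution $x:\mathbb{R}_{\ge 0}\to(\mathbb{R}^2)^N$ such that $x(0)=x^0$ and $x(t)\in(\mathbb{R}^2)^N\setminus S$ for every $t>0$.
   Context: Configurations are $x=(x_1,\dots,x_N)\in(\mathbb{R}^2)^N$, where $x_i$ is the position of agent $i$, and $\|\cdot\|$ is the Euclidean norm on $\mathbb{R}^2$. The set of degenerate configurations is $S=\{x: \exists\, i\neq j \text{ with } x_i=x_j\}$, and the set of switching configurations is $D=\{x:\exists\, i,j,k\in\{1,\dots,N\} \text{ (with } j\ne k, j,k\ne i) \text{ s.t. } \|x_i-x_j\|=\|x_i-x_k\|\}$. For $x\notin D\cup S$, each agent $i$ has a unique closest neighbor $c_i(x)=\arg\min_{j\neq i}\|x_i-x_j\|$, and the vector field $f:(\mathbb{R}^2)^N\setminus(D\cup S)\to(\mathbb{R}^2)^N$ is defined componentwise by $$f_i(x)=\big(x_{c_i(x)}-x_i\big)-\xi^2\,\frac{x_{c_i(x)}-x_i}{\|x_{c_i(x)}-x_i\|^2},\qquad i=1,\dots,N.$$ For $y\in(\mathbb{R}^2)^N$, set $K f(y)=\bigcap_{\delta>0}\bigcap_{\mu(\Lambda)=0}\overline{\mathrm{co}}\{f(B(y,\delta)\setminus\Lambda)\}$,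 where $B(y,\delta)$ is the open Euclidean ball of radius $\delta$ centered at $y$, $\overline{\mathrm{co}}$ denotes the closed convex hull, $\mu$ is Lebesgue measure, and the inner intersection is over all Lebesgue-null sets $\Lambda$ (points where $f$ is undefined are discarded). A map $x:\mathbb{R}_{\ge0}\to(\mathbb{R}^2)^N$ is a Filippov solution of $\dot x=f(x)$ if it is absolutely continuous and $\dot x(t)\in K f(x(t))$ for almost every $t>0$. *)

theory Defs
  imports "HOL-Analysis.Analysis"
begin

text \<open>Configurations of agents indexed by the finite type 'n (N = CARD('n)),
  each agent at a point of the plane real^2. The configuration space is
  (real^2)^'n with its Euclidean norm.\<close>

definition degenerate_set :: "((real^2)^'n::finite) set" where
  "degenerate_set = {x. \<exists>i j. i \<noteq> j \<and> x$i = x$j}"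

definition switching_set :: "((real^2)^'n::finite) set" where
  "switching_set = {x. \<exists>i j k. j \<noteq> k \<and> j \<noteq> i \<and> k \<noteq> i \<and>
      norm (x$i - x$j) = norm (x$i - x$k)}"

text \<open>Unique closest neighbour (meaningful outside switching_set and degenerate_set).\<close>
definition closest :: "(real^2)^'n::finite \<Rightarrow> 'n \<Rightarrow> 'n" where
  "closest x i = (THE j. j \<noteq> i \<and>
      (\<forall>k. k \<noteq> i \<and> k \<noteq> j \<longrightarrow> norm (x$i - x$j) < norm (x$i - x$k)))"

definition nn_field :: "real \<Rightarrow> (real^2)^'n::finite \<Rightarrow> (real^2)^'n" where
  "nn_field \<xi> x = (\<chi> i. (x$(closest x i) - x$i)
      - (\<xi>^2 / (norm (x$(closest x i) - x$i))^2) *\<^sub>R (x$(closest x i) - x$i))"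

definition filippov_set :: "((real^2)^'n::finite \<Rightarrow> (real^2)^'n) \<Rightarrow> (real^2)^'n \<Rightarrow> ((real^2)^'n) set" where
  "filippov_set F y = (\<Inter>\<delta>\<in>{\<delta>. \<delta> > 0}. \<Inter>\<Lambda>\<in>null_sets lebesgue.
      closure (convex hull (F ` (ball y \<delta> - \<Lambda> - (switching_set \<union> degenerate_set)))))"

definition abs_continuous_on :: "real \<Rightarrow> real \<Rightarrow> (real \<Rightarrow> 'a::real_normed_vector) \<Rightarrow> bool" where
  "abs_continuous_on a b g \<longleftrightarrow> (\<forall>\<epsilon>>0. \<exists>\<delta>>0. \<forall>(n::nat) (u::nat \<Rightarrow> real) v.
      (\<forall>k<n. a \<le> u k \<and> u k \<le> v k \<and> v k \<le> b) \<and>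
      (\<forall>k<n. \<forall>l<n. k \<noteq> l \<longrightarrow> v k \<le> u l \<or> v l \<le> u k) \<and>
      (\<Sum>k<n. v k - u k) < \<delta> \<longrightarrow> (\<Sum>k<n. norm (g (v k) - g (u k))) < \<epsilon>)"

definition filippov_solution :: "((real^2)^'n::finite \<Rightarrow> (real^2)^'n) \<Rightarrow> (real \<Rightarrow> (real^2)^'n) \<Rightarrow> bool" where
  "filippov_solution F x \<longleftrightarrow> (\<forall>T\<ge>0. abs_continuous_on 0 T x) \<and>
     (AE t in lborel. t > 0 \<longrightarrow>
        (\<exists>v. (x has_vector_derivative v) (at t) \<and> v \<in> filippov_set F (x t)))"

end

theory Submission
  imports Defs
begin

text \<open>
  Collisions are excluded by looking at whole clusters instead of the closest pair. Let a set of \<open>k\<close>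
  agents have diameter below \<open>\<xi>\<close> and be farther from all other agents than its diameter. Then every
  agent of the cluster is repelled by a point of the cluster, so the two agents realising the diameter
  move apart, and this survives convex combinations of the field. If all clusters of \<open>k + 1\<close> agents have
  diameter at least \<open>4 r\<close>, a cluster of \<open>k\<close> agents of diameter below \<open>r\<close> is automatically isolated;
  downward induction on \<open>k\<close> therefore bounds all diameters, in particular all distances, from below.

  The bound is proved for Euler polygons, with errors that vanish with the step size. A limit of the
  polygons is locally Lipschitz, hence differentiable almost everywhere, and its difference quotients are
  limits of averages of nearby values of the field.
\<close>

section \<open>Lipschitz curves are differentiable almost everywhere\<close>

lemma Vitali_disjoint_balls:
  fixes E :: "'a::euclidean_space set"
  assumes "\<And>t d. t \<in> E \<Longrightarrow> 0 < d \<Longrightarrow> \<exists>c r. t \<in> ball c r \<and> r < d \<and> P c r"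
  obtains C where "countable C" "\<And>c r. (c, r) \<in> C \<Longrightarrow> P c r"
    "disjoint_family_on (\<lambda>(c, r). ball c r) C" "negligible (E - (\<Union>(c, r)\<in>C. ball c r))"
proof -
  have *: "\<exists>i. i \<in> {(c, r). P c r \<and> 0 < r} \<and> t \<in> ball (fst i) (snd i) \<and> snd i < d"
    if td: "t \<in> E" "0 < d" for t d
  proof -
    obtain c r where cr: "t \<in> ball c r" "r < d" "P c r" using assms[OF td] by blast
    then have "0 < r" by (metis ball_eq_empty empty_iff not_le)
    with cr show ?thesis by (intro exI[of _ "(c, r)"]) auto
  qed
  obtain C where C: "countable C" "C \<subseteq> {(c, r). P c r \<and> 0 < r}"
    "pairwise (\<lambda>i j. disjnt (ball (fst i) (snd i)) (ball (fst j) (snd j))) C"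
    "negligible (E - (\<Union>i \<in> C. ball (fst i) (snd i)))"
    by (rule Vitali_covering_theorem_balls[of E "{(c, r). P c r \<and> 0 < r}" fst snd, OF *])
  show thesis
  proof
    show "countable C" by fact
    show "\<And>c r. (c, r) \<in> C \<Longrightarrow> P c r" using C(2) by auto
    show "disjoint_family_on (\<lambda>(c, r). ball c r) C"
      using C(3) by (auto simp: disjoint_family_on_def pairwise_def disjnt_def split_beta)
    show "negligible (E - (\<Union>(c, r)\<in>C. ball c r))"
      using C(4) by (simp add: split_beta)
  qed
qed

lemma emeasure_disjoint_balls:
  fixes M :: "'a::euclidean_space measure"
  assumes "sets M = sets borel" "countable C" "disjoint_family_on (\<lambda>(c, r). ball c r) C"
  shows "emeasure M (\<Union>(c, r)\<in>C. ball c r) = (\<integral>\<^sup>+ i. emeasure M (ball (fst i) (snd i)) \<partial>count_space C)"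
  using emeasure_UN_countable[of C "\<lambda>(c, r). ball c r" M] assms by (auto simp: split_beta)

text \<open>Asking only that the balls contain the point, rather than be centred at it, makes these sets
  open, so the set of points with a density gap is a Borel set.\<close>

definition density_le :: "'a::euclidean_space measure \<Rightarrow> real \<Rightarrow> real \<Rightarrow> 'a set" where
  "density_le M p d = (\<Union>(c, r)\<in>{(c, r). r < d \<and> emeasure M (ball c r) \<le> ennreal p * emeasure lborel (ball c r)}. ball c r)"

definition density_ge :: "'a::euclidean_space measure \<Rightarrow> real \<Rightarrow> real \<Rightarrow> 'a set" where
  "density_ge M q d = (\<Union>(c, r)\<in>{(c, r). r < d \<and> ennreal q * emeasure lborel (ball c r) \<le> emeasure M (ball c r)}. ball c r)"

lemma density_leI:
  "t \<in> ball c r \<Longrightarrow> r < d \<Longrightarrow> emeasure M (ball c r) \<le> ennreal p * emeasure lborel (ball c r) \<Longrightarrow> t \<in> density_le M p d"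
  unfolding density_le_def by blast

lemma density_geI:
  "t \<in> ball c r \<Longrightarrow> r < d \<Longrightarrow> ennreal q * emeasure lborel (ball c r) \<le> emeasure M (ball c r) \<Longrightarrow> t \<in> density_ge M q d"
  unfolding density_ge_def by blast

lemma negligible_density_gap:
  fixes M :: "'a::euclidean_space measure"
  assumes M: "sets M = sets borel" and pq: "0 \<le> p" "p < q"
  shows "negligible (\<Inter>n. density_le M p (1 / Suc n) \<inter> density_ge M q (1 / Suc n))"
    (is "negligible ?E")
proof (rule negligible_on_intervals[THEN iffD2], intro allI)
  fix a b :: 'a
  define E where "E = ?E \<inter> cbox a b"
  have "open (density_le M p d)" "open (density_ge M q d)" for d
    by (auto simp: density_le_def density_ge_def)
  then have Eb: "E \<in> sets borel" unfolding E_def by (intro sets.Int sets.countable_INT) auto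
  have fin: "emeasure lborel E < \<infinity>"
    by (rule le_less_trans[OF emeasure_mono[of _ "cbox a b"]]) (auto simp: E_def emeasure_lborel_cbox_eq)
  have small: "\<exists>c r. t \<in> ball c r \<and> r < d \<and> (ball c r \<subseteq> W \<and> emeasure M (ball c r) \<le> ennreal p * emeasure lborel (ball c r))"
     "\<exists>c r. t \<in> ball c r \<and> r < d \<and> (ball c r \<subseteq> W \<and> ennreal q * emeasure lborel (ball c r) \<le> emeasure M (ball c r))"
    if t: "t \<in> E" "t \<in> W" "open W" "0 < d" for t d W
  proof -
    obtain e where e: "0 < e" "ball t e \<subseteq> W" using t by (meson openE)
    obtain n where n: "1 / Suc n < min (e/2) d" using nat_approx_posE[of "min (e/2) d"] e t by auto
    have sub: "ball c r \<subseteq> W" if "t \<in> ball c r" "r < 1 / Suc n" for c r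
    proof -
      have "ball c r \<subseteq> ball t e"
      proof
        fix z assume "z \<in> ball c r"
        then have "dist t z < r + r" using that dist_triangle2[of t z c] by (simp add: dist_commute)
        then show "z \<in> ball t e" using that n by simp
      qed
      with e show ?thesis by blast
    qed
    have "t \<in> density_le M p (1 / Suc n)" "t \<in> density_ge M q (1 / Suc n)"
      using t(1) unfolding E_def by auto
    then obtain c r c' r' where
      "t \<in> ball c r" "r < 1 / Suc n" "emeasure M (ball c r) \<le> ennreal p * emeasure lborel (ball c r)"
      "t \<in> ball c' r'" "r' < 1 / Suc n" "ennreal q * emeasure lborel (ball c' r') \<le> emeasure M (ball c' r')"
      unfolding density_le_def density_ge_def by auto
    moreover have "1 / Suc n < d" using n by simp
    ultimately show "\<exists>c r. t \<in> ball c r \<and> r < d \<and> (ball c r \<subseteq> W \<and> emeasure M (ball c r) \<le> ennreal p * emeasure lborel (ball c r))"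
     "\<exists>c r. t \<in> ball c r \<and> r < d \<and> (ball c r \<subseteq> W \<and> ennreal q * emeasure lborel (ball c r) \<le> emeasure M (ball c r))"
      using sub by (meson less_trans)+
  qed
  have key: "ennreal q * emeasure lborel E \<le> ennreal p * (emeasure lborel E + ennreal e)" if e: "0 < e" for e
  proof -
    obtain U where U: "E \<subseteq> U" "open U" "emeasure lborel (U - E) < ennreal e"
      using outer_regular_lborel[OF Eb] e by metis
    obtain C where C: "countable C" "\<And>c r. (c, r) \<in> C \<Longrightarrow> ball c r \<subseteq> U \<and> emeasure M (ball c r) \<le> ennreal p * emeasure lborel (ball c r)"
      "disjoint_family_on (\<lambda>(c, r). ball c r) C" "negligible (E - (\<Union>(c, r)\<in>C. ball c r))"
      by (rule Vitali_disjoint_balls[OF small(1)[OF _ _ \<open>open U\<close>], of E]) (use U(1) in auto)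
    define W where "W = (\<Union>(c, r)\<in>C. ball c r)"
    have oW: "open W" unfolding W_def by auto
    obtain B where B: "countable B" "\<And>c r. (c, r) \<in> B \<Longrightarrow> ball c r \<subseteq> W \<and> ennreal q * emeasure lborel (ball c r) \<le> emeasure M (ball c r)"
      "disjoint_family_on (\<lambda>(c, r). ball c r) B" "negligible (E \<inter> W - (\<Union>(c, r)\<in>B. ball c r))"
      by (rule Vitali_disjoint_balls[OF small(2)[OF _ _ oW], of "E \<inter> W"]) auto
    define V where "V = (\<Union>(c, r)\<in>B. ball c r)"
    have oV: "open V" unfolding V_def by auto
    have neg: "negligible (E - V)"
      by (rule negligible_subset[OF negligible_Un[OF C(4) B(4)]]) (auto simp: V_def W_def)
    have "emeasure lborel E \<le> emeasure lborel V"
    proof -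
      have "emeasure lborel E \<le> emeasure lborel (V \<union> (E - V))"
        using Eb oV by (intro emeasure_mono) auto
      also have "\<dots> \<le> emeasure lborel V + emeasure lborel (E - V)"
        using Eb oV by (intro emeasure_subadditive) auto
      also have "emeasure lborel (E - V) = 0"
        using neg Eb oV by (simp add: negligible_iff_emeasure0 borel_open sets.Diff)
      finally show ?thesis by simp
    qed
    then have "ennreal q * emeasure lborel E \<le> ennreal q * emeasure lborel V"
      by (rule mult_left_mono) simp
    also have "\<dots> \<le> emeasure M V"
      unfolding V_def emeasure_disjoint_balls[OF M B(1) B(3)] emeasure_disjoint_balls[OF sets_lborel B(1) B(3)]
      using B(2) by (subst nn_integral_cmult[symmetric]) (auto intro!: nn_integral_mono)
    also have "\<dots> \<le> emeasure M W"
      using oW M B(2) by (intro emeasure_mono) (auto simp: V_def)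
    also have "\<dots> \<le> ennreal p * emeasure lborel W"
      unfolding W_def emeasure_disjoint_balls[OF M C(1) C(3)] emeasure_disjoint_balls[OF sets_lborel C(1) C(3)]
      using C(2) by (subst nn_integral_cmult[symmetric]) (auto intro!: nn_integral_mono)
    also have "emeasure lborel W \<le> emeasure lborel U"
      using U C(2) by (intro emeasure_mono) (auto simp: W_def)
    also have "emeasure lborel U \<le> emeasure lborel (E \<union> (U - E))"
      using U Eb by (intro emeasure_mono) auto
    also have "\<dots> \<le> emeasure lborel E + emeasure lborel (U - E)"
      using U Eb by (intro emeasure_subadditive) auto
    also have "emeasure lborel (U - E) \<le> ennreal e" using U by simp
    finally show ?thesis by (simp add: mult_left_mono)
  qed
  define s where "s = measure lborel E"
  have s: "emeasure lborel E = ennreal s" "0 \<le> s"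
    using fin by (auto simp: s_def emeasure_eq_ennreal_measure)
  have "q * s \<le> p * (s + e)" if "0 < e" for e
    using key[OF that] s pq that
    by (simp add: ennreal_plus[symmetric] ennreal_mult'[symmetric] del: ennreal_plus)
  moreover have "((\<lambda>e. p * (s + e)) \<longlongrightarrow> p * (s + 0)) (at_right 0)"
    by (intro tendsto_intros)
  ultimately have "q * s \<le> p * (s + 0)"
    by (intro tendsto_lowerbound[where F="at_right 0"]) (auto simp: eventually_at_right_less eventually_at_filter)
  then have "s = 0" using s(2) pq by (auto simp: mult_le_cancel_right)
  then have "emeasure lborel E = 0" using s by simp
  then show "negligible (?E \<inter> cbox a b)"
    using Eb unfolding E_def by (simp add: negligible_iff_emeasure0)
qed

lemma tendsto_exists_if_separated:
  fixes Q :: "'a \<Rightarrow> real"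
  assumes F: "F \<noteq> bot" and bd: "eventually (\<lambda>x. 0 \<le> Q x) F" "eventually (\<lambda>x. Q x \<le> K) F"
    and sep: "\<And>p q. 0 \<le> p \<Longrightarrow> p < q \<Longrightarrow> p \<in> \<rat> \<Longrightarrow> q \<in> \<rat> \<Longrightarrow> eventually (\<lambda>x. p \<le> Q x) F \<or> eventually (\<lambda>x. Q x \<le> q) F"
  shows "\<exists>l. (Q \<longlongrightarrow> l) F"
proof -
  define A where "A = {p. eventually (\<lambda>x. p \<le> Q x) F}"
  have K: "p \<le> K" if "p \<in> A" for p
  proof -
    have "eventually (\<lambda>x. p \<le> Q x \<and> Q x \<le> K) F"
      using that bd(2) unfolding A_def by (auto intro: eventually_conj)
    then have "eventually (\<lambda>x. p \<le> K) F" by (rule eventually_mono) auto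
    with F show ?thesis by simp
  qed
  then have A: "0 \<in> A" "bdd_above A" using bd(1) by (auto simp: A_def bdd_above_def)
  have "(Q \<longlongrightarrow> Sup A) F"
  proof (rule order_tendstoI)
    fix a assume "a < Sup A"
    then obtain p where "p \<in> A" "a < p" using less_cSup_iff[of A a] A by blast
    then show "eventually (\<lambda>x. a < Q x) F"
      unfolding A_def by (auto elim: eventually_mono)
  next
    fix a assume a: "Sup A < a"
    obtain p where p: "p \<in> \<rat>" "Sup A < p" "p < a" using Rats_dense_in_real[OF a] by blast
    obtain q where q: "q \<in> \<rat>" "p < q" "q < a" using Rats_dense_in_real[OF p(3)] by blast
    have "p \<notin> A" using p(2) A(2) cSup_upper by fastforce
    moreover have "0 \<le> p" using p(2) cSup_upper[OF A] by simp
    ultimately have "eventually (\<lambda>x. Q x \<le> q) F"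
      using sep[of p q] p q unfolding A_def by blast
    then show "eventually (\<lambda>x. Q x < a) F"
      by (rule eventually_mono) (use q in auto)
  qed
  then show ?thesis ..
qed

lemma eventually_difference_quotient:
  fixes g :: "real \<Rightarrow> real"
  assumes g: "continuous_on UNIV g" and d: "0 < d"
    and le: "\<And>u v. u < t \<Longrightarrow> t < v \<Longrightarrow> v - u < d \<Longrightarrow> p * (v - u) \<le> g v - g u"
  shows "eventually (\<lambda>h. p \<le> (g (t + h) - g t) / h) (at 0)"
proof -
  have "p \<le> (g (t + h) - g t) / h" if h: "h \<noteq> 0" "\<bar>h\<bar> < d" for h
  proof -
    have ev: "eventually (\<lambda>e::real. 0 < e \<and> e < d - \<bar>h\<bar>) (at_right 0)"
      using h eventually_at_right_real[of 0 "d - \<bar>h\<bar>"] by (auto elim: eventually_mono)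
    have lim1: "((\<lambda>e. t - e) \<longlongrightarrow> t) (at_right 0)" "((\<lambda>e. t + e) \<longlongrightarrow> t) (at_right 0)"
      by (auto intro!: tendsto_eq_intros)
    have lim: "((\<lambda>e. g (t - e)) \<longlongrightarrow> g t) (at_right 0)" "((\<lambda>e. g (t + e)) \<longlongrightarrow> g t) (at_right 0)"
      using lim1 g by (auto intro: continuous_on_tendsto_compose)
    show ?thesis
    proof (cases "h > 0")
      case True
      have "p * (h + 0) \<le> g (t + h) - g t"
      proof (rule tendsto_le[of "at_right 0"])
        show "((\<lambda>e. p * (h + e)) \<longlongrightarrow> p * (h + 0)) (at_right 0)" by (intro tendsto_intros)
        show "((\<lambda>e. g (t + h) - g (t - e)) \<longlongrightarrow> g (t + h) - g t) (at_right 0)" by (intro tendsto_intros lim)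
        show "eventually (\<lambda>e. p * (h + e) \<le> g (t + h) - g (t - e)) (at_right 0)"
          using ev
        proof (rule eventually_mono)
          fix e assume "0 < e \<and> e < d - \<bar>h\<bar>"
          then show "p * (h + e) \<le> g (t + h) - g (t - e)" using le[of "t - e" "t + h"] True by simp
        qed
      qed simp
      then show ?thesis using True by (simp add: field_simps)
    next
      case False
      have "p * (0 - h) \<le> g t - g (t + h)"
      proof (rule tendsto_le[of "at_right 0"])
        show "((\<lambda>e. p * (e - h)) \<longlongrightarrow> p * (0 - h)) (at_right 0)" by (intro tendsto_intros)
        show "((\<lambda>e. g (t + e) - g (t + h)) \<longlongrightarrow> g t - g (t + h)) (at_right 0)" by (intro tendsto_intros lim)
        show "eventually (\<lambda>e. p * (e - h) \<le> g (t + e) - g (t + h)) (at_right 0)"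
          using ev
        proof (rule eventually_mono)
          fix e assume "0 < e \<and> e < d - \<bar>h\<bar>"
          then show "p * (e - h) \<le> g (t + e) - g (t + h)" using le[of "t + h" "t + e"] False h by simp
        qed
      qed simp
      then show ?thesis using False h by (simp add: field_simps)
    qed
  qed
  then show ?thesis using d by (auto simp: eventually_at dist_real_def)
qed

lemma mono_lipschitz_differentiable_ae:
  fixes g :: "real \<Rightarrow> real"
  assumes mono: "mono g" and lip: "K-lipschitz_on UNIV g"
  shows "negligible {t. \<not> g differentiable at t}"
proof -
  have cont: "continuous_on UNIV g" by (rule lipschitz_on_continuous_on[OF lip])
  define M where "M = interval_measure g"
  have sM: "sets M = sets borel" by (simp add: M_def)
  have ivl: "emeasure M {u<..<v} = ennreal (g v - g u)" if "u < v" for u v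
  proof -
    have Icc: "emeasure M {a..b} = ennreal (g b - g a)" if "a \<le> b" for a b
      unfolding M_def by (rule emeasure_interval_measure_Icc) (use that mono cont in \<open>auto simp: mono_def\<close>)
    have "emeasure M {u..v} = emeasure M ({u<..<v} \<union> ({u..u} \<union> {v..v}))"
      using that by (intro arg_cong[where f="emeasure M"]) auto
    also have "\<dots> = emeasure M {u<..<v}"
    proof (rule emeasure_Un_null_set)
      have "{a..a} \<in> null_sets M" for a
        using Icc[of a a] by (simp add: null_sets_def sM del: atLeastAtMost_singleton)
      from this[of u] this[of v] show "{u..u} \<union> {v..v} \<in> null_sets M" by (rule null_sets.Un)
    qed (simp add: sM)
    finally show ?thesis using Icc[of u v] that by simp
  qed
  define N where "N p q = (\<Inter>n. density_le M p (1 / Suc n) \<inter> density_ge M q (1 / Suc n))" for p q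
  define P where "P = {(p, q). p \<in> \<rat> \<and> q \<in> \<rat> \<and> 0 \<le> p \<and> p < (q::real)}"
  have "countable P"
    by (rule countable_subset[OF _ countable_SIGMA[OF countable_rat, of "\<lambda>_. \<rat>"]]) (auto simp: P_def countable_rat)
  then have "negligible (\<Union>(p, q)\<in>P. N p q)"
    by (intro negligible_countable_Union)
       (auto simp: P_def N_def simp del: of_nat_Suc intro!: negligible_density_gap sM)
  moreover have "g differentiable at t" if t: "t \<notin> (\<Union>(p, q)\<in>P. N p q)" for t
  proof -
    have "\<exists>l. ((\<lambda>h. (g (t + h) - g t) / h) \<longlongrightarrow> l) (at 0)"
    proof (rule tendsto_exists_if_separated[where K = K])
      show "eventually (\<lambda>h. 0 \<le> (g (t + h) - g t) / h) (at 0)"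
        by (rule eventually_difference_quotient[OF cont zero_less_one]) (use mono in \<open>auto simp: mono_def\<close>)
      have "\<bar>(g (t + h) - g t) / h\<bar> \<le> K" if "h \<noteq> 0" for h
        using lipschitz_onD[OF lip, of "t + h" t] that by (simp add: dist_real_def field_simps)
      then show "eventually (\<lambda>h. (g (t + h) - g t) / h \<le> K) (at 0)"
        by (intro eventually_at_filter[THEN iffD2] always_eventually) (blast intro: order_trans[OF abs_ge_self])
    next
      fix p q :: real assume pq: "0 \<le> p" "p < q" "p \<in> \<rat>" "q \<in> \<rat>"
      with t obtain n where n: "t \<notin> density_le M p (1 / Suc n) \<or> t \<notin> density_ge M q (1 / Suc n)"
        unfolding P_def N_def by auto
      have str: "t \<in> ball ((u + v) / 2) ((v - u) / 2)" "(v - u) / 2 < 1 / Suc n"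
        "emeasure M (ball ((u + v) / 2) ((v - u) / 2)) = ennreal (g v - g u)"
        "emeasure lborel (ball ((u + v) / 2) ((v - u) / 2)) = ennreal (v - u)"
        "0 \<le> g v - g u"
        if "u < t" "t < v" "v - u < 1 / Suc n" for u v
      proof -
        have b: "ball ((u + v) / 2) ((v - u) / 2) = {u<..<v}"
          by (auto simp: ball_eq_greaterThanLessThan field_simps)
        show "t \<in> ball ((u + v) / 2) ((v - u) / 2)"  "emeasure M (ball ((u + v) / 2) ((v - u) / 2)) = ennreal (g v - g u)"
          "emeasure lborel (ball ((u + v) / 2) ((v - u) / 2)) = ennreal (v - u)"
          unfolding b using that ivl[of u v] by auto
        show "(v - u) / 2 < 1 / Suc n" using that by auto
        show "0 \<le> g v - g u" using mono that by (auto simp: mono_def)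
      qed
      from n show "eventually (\<lambda>h. p \<le> (g (t + h) - g t) / h) (at 0) \<or> eventually (\<lambda>h. (g (t + h) - g t) / h \<le> q) (at 0)"
      proof
        assume nt: "t \<notin> density_le M p (1 / Suc n)"
        have "p * (v - u) \<le> g v - g u" if uv: "u < t" "t < v" "v - u < 1 / Suc n" for u v
        proof -
          have "\<not> ennreal (g v - g u) \<le> ennreal p * ennreal (v - u)"
            using nt density_leI[OF str(1,2)[OF uv], of M p] str(3,4)[OF uv] by auto
          then show ?thesis using pq uv by (auto simp: ennreal_mult'[symmetric] ennreal_le_iff)
        qed
        then show ?thesis using eventually_difference_quotient[OF cont, of "1 / Suc n" t p] by auto
      next
        assume nt: "t \<notin> density_ge M q (1 / Suc n)"
        have "- q * (v - u) \<le> - g v - (- g u)" if uv: "u < t" "t < v" "v - u < 1 / Suc n" for u v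
        proof -
          have "\<not> ennreal q * ennreal (v - u) \<le> ennreal (g v - g u)"
            using nt density_geI[OF str(1,2)[OF uv], of q M] str(3,4)[OF uv] by auto
          then show ?thesis using pq uv str(5)[OF uv] by (auto simp: ennreal_mult'[symmetric] ennreal_le_iff)
        qed
        then have "eventually (\<lambda>h. - q \<le> (- g (t + h) - - g t) / h) (at 0)"
          using eventually_difference_quotient[OF continuous_on_minus[OF cont], of "1 / Suc n" t "- q"] by auto
        then have "eventually (\<lambda>h. (g (t + h) - g t) / h \<le> q) (at 0)"
          by (rule eventually_mono) (simp add: diff_divide_distrib)
        then show ?thesis ..
      qed
    qed simp
    then show ?thesis
      by (auto simp: DERIV_def[symmetric] real_differentiable_def)
  qed
  ultimately show ?thesis by (elim negligible_subset) blast
qed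

lemma lipschitz_differentiable_ae_real:
  fixes f :: "real \<Rightarrow> real"
  assumes lip: "L-lipschitz_on UNIV f"
  shows "negligible {t. \<not> f differentiable at t}"
proof -
  define g where "g t = f t + L * t" for t
  have L: "0 \<le> L" using lip by (rule lipschitz_on_nonneg)
  have b: "\<bar>f x - f y\<bar> \<le> L * \<bar>x - y\<bar>" for x y using lipschitz_onD[OF lip, of x y] by (simp add: dist_real_def)
  have "mono g" unfolding g_def
  proof (rule monoI)
    fix x y :: real assume "x \<le> y"
    then show "f x + L * x \<le> f y + L * y" using b[of x y] by (simp add: algebra_simps)
  qed
  moreover have "(L + L)-lipschitz_on UNIV g"
    unfolding g_def using lipschitz_on_add[OF lip, of "L" "\<lambda>t. L * t"] L
    by (auto simp: lipschitz_on_def dist_real_def abs_mult right_diff_distrib[symmetric])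
  ultimately have "negligible {t. \<not> g differentiable at t}" by (rule mono_lipschitz_differentiable_ae)
  moreover have "f differentiable at t" if "g differentiable at t" for t
  proof -
    have "(\<lambda>t. g t - L * t) differentiable at t" using that by (intro derivative_intros) auto
    then show ?thesis by (simp add: g_def)
  qed
  ultimately show ?thesis by (auto elim!: negligible_subset)
qed

lemma lipschitz_differentiable_ae:
  fixes f :: "real \<Rightarrow> 'a::euclidean_space"
  assumes lip: "L-lipschitz_on UNIV f"
  shows "negligible {t. \<not> f differentiable at t}"
proof -
  have "L-lipschitz_on UNIV (\<lambda>t. f t \<bullet> b)" if "b \<in> Basis" for b
  proof (rule lipschitz_onI)
    fix x y show "dist (f x \<bullet> b) (f y \<bullet> b) \<le> L * dist x y"
      using lipschitz_onD[OF lip, of x y] Basis_le_norm[OF that, of "f x - f y"]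
      by (simp add: dist_norm inner_diff_left)
  qed (rule lipschitz_on_nonneg[OF lip])
  then have "negligible (\<Union>b\<in>Basis. {t. \<not> (\<lambda>t. f t \<bullet> b) differentiable at t})"
    by (intro negligible_Union) (auto intro: lipschitz_differentiable_ae_real)
  then show ?thesis
    by (rule negligible_subset) (auto simp: differentiable_componentwise_within[of f])
qed

lemma locally_lipschitz_differentiable_AE:
  fixes x :: "real \<Rightarrow> 'a::euclidean_space"
  assumes lip: "\<And>T. 0 \<le> T \<Longrightarrow> (L T)-lipschitz_on {0..T} x"
  shows "AE t in lborel. 0 < t \<longrightarrow> x differentiable at t"
proof -
  define f where "f n t = x (max 0 (min (real n) t))" for n t
  have "(L (real n))-lipschitz_on UNIV (f n)" for n
  proof (rule lipschitz_onI)
    fix s t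
    have "dist (f n s) (f n t) \<le> L (real n) * dist (max 0 (min (real n) s)) (max 0 (min (real n) t))"
      unfolding f_def by (rule lipschitz_onD[OF lip]) auto
    also have "\<dots> \<le> L (real n) * dist s t"
      using lipschitz_on_nonneg[OF lip[of "real n"]] by (intro mult_left_mono) (auto simp: dist_real_def)
    finally show "dist (f n s) (f n t) \<le> L (real n) * dist s t" .
  qed (use lipschitz_on_nonneg[OF lip[of "real n"]] in simp)
  then have "negligible (\<Union>n. {t. \<not> f n differentiable at t})"
    by (intro negligible_countable_Union) (auto intro: lipschitz_differentiable_ae)
  then have "(\<Union>n. {t. \<not> f n differentiable at t}) \<in> null_sets lebesgue"
    by (simp add: negligible_iff_null_sets)
  then have "AE t in lebesgue. 0 < t \<longrightarrow> x differentiable at t"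
  proof (rule AE_I')
    show "{t \<in> space lebesgue. \<not> (0 < t \<longrightarrow> x differentiable at t)} \<subseteq> (\<Union>n. {t. \<not> f n differentiable at t})"
    proof
      fix t :: real assume "t \<in> {t \<in> space lebesgue. \<not> (0 < t \<longrightarrow> x differentiable at t)}"
      then have t: "0 < t" "\<not> x differentiable at t" by auto
      obtain n where n: "t < real n" using reals_Archimedean2 by blast
      have "\<not> f n differentiable at t"
      proof
        assume "f n differentiable at t"
        then obtain D where "(f n has_derivative D) (at t)" unfolding differentiable_def by blast
        then have "(x has_derivative D) (at t)"
          by (rule has_derivative_transform_within_open[of _ _ _ _ "{0<..<real n}"]) (use t n in \<open>auto simp: f_def\<close>)
        with t(2) show False unfolding differentiable_def by blast
      qed
      then show "t \<in> (\<Union>n. {t. \<not> f n differentiable at t})" by blast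
    qed
  qed
  then show ?thesis by (simp add: AE_completion_iff)
qed

section \<open>Limits of Euler polygons\<close>

text \<open>An uncountable product of balls is compact but not sequentially compact, hence a filter finer
  than \<open>sequentially\<close> in place of a subsequence.\<close>

lemma pointwise_convergent_subfilter:
  fixes X :: "nat \<Rightarrow> 'b \<Rightarrow> 'a::euclidean_space"
  assumes R: "\<And>k t. norm (X k t) \<le> R t"
  obtains \<F> x where "\<F> \<noteq> bot" "\<F> \<le> sequentially" "\<And>t. ((\<lambda>k. X k t) \<longlongrightarrow> x t) \<F>"
proof -
  define U where "U = (\<Pi>\<^sub>E t\<in>UNIV. cball (0::'a) (R t))"
  have "compactin (product_topology (\<lambda>_. euclidean) UNIV) U"
    unfolding U_def compactin_PiE by simp
  then have "compact U" by (simp add: euclidean_product_topology)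
  moreover have "filtermap X sequentially \<noteq> bot" by (simp add: filtermap_bot_iff)
  moreover have "eventually (\<lambda>x. x \<in> U) (filtermap X sequentially)"
    using R by (auto simp: eventually_filtermap U_def PiE_iff)
  ultimately obtain x where x: "inf (nhds x) (filtermap X sequentially) \<noteq> bot"
    unfolding compact_filter by blast
  define \<F> where "\<F> = inf (filtercomap X (nhds x)) sequentially"
  have "\<F> \<noteq> bot"
  proof
    assume "\<F> = bot"
    then have "eventually (\<lambda>_. False) \<F>" by simp
    then obtain P Q where PQ: "eventually P (nhds x)" "eventually Q sequentially" "\<And>k. P (X k) \<Longrightarrow> Q k \<Longrightarrow> False"
      unfolding \<F>_def eventually_inf eventually_filtercomap by blast
    have "eventually (\<lambda>_. False) (inf (nhds x) (filtermap X sequentially))"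
      unfolding eventually_inf
    proof (intro exI conjI)
      show "eventually (\<lambda>y. \<exists>k. y = X k \<and> Q k) (filtermap X sequentially)"
        unfolding eventually_filtermap using PQ(2) by (auto elim: eventually_mono)
    qed (use PQ in auto)
    with x show False by (simp add: trivial_limit_def)
  qed
  moreover have "\<F> \<le> sequentially" by (simp add: \<F>_def)
  moreover have "((\<lambda>k. X k t) \<longlongrightarrow> x t) \<F>" for t
  proof -
    have "filterlim X (nhds x) \<F>"
      unfolding filterlim_iff_le_filtercomap \<F>_def by simp
    moreover have "continuous_on UNIV (\<lambda>x. x t :: 'a)" by (rule continuous_on_product_coordinates)
    ultimately show ?thesis
      using continuous_on_tendsto_compose[of UNIV "\<lambda>x. x t" X x \<F>] by simp
  qed
  ultimately show thesis by (rule that)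
qed

lemma has_vector_derivative_in_closed:
  fixes x :: "real \<Rightarrow> 'a::real_normed_vector"
  assumes "(x has_vector_derivative v) (at t)" "closed C" "0 < e"
    and "\<And>s. t < s \<Longrightarrow> s < t + e \<Longrightarrow> (x s - x t) /\<^sub>R (s - t) \<in> C"
  shows "v \<in> C"
proof (rule Lim_in_closed_set[of C _ "at_right t"])
  have "((\<lambda>s. norm (x s - x t - (s - t) *\<^sub>R v) / norm (s - t)) \<longlongrightarrow> 0) (at t)"
    using assms(1) unfolding has_vector_derivative_def has_derivative_iff_norm by blast
  moreover have "norm (x s - x t - (s - t) *\<^sub>R v) / norm (s - t) = norm ((x s - x t) /\<^sub>R (s - t) - v)" if "s \<noteq> t" for s
  proof -
    have "(x s - x t) /\<^sub>R (s - t) - v = (x s - x t - (s - t) *\<^sub>R v) /\<^sub>R (s - t)"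
      using that by (simp add: scaleR_diff_right)
    then show ?thesis by (simp add: divide_inverse_commute)
  qed
  ultimately have "((\<lambda>s. norm ((x s - x t) /\<^sub>R (s - t) - v)) \<longlongrightarrow> 0) (at t)"
    by (elim Lim_transform_eventually) (auto simp: eventually_at_filter)
  then have "((\<lambda>s. (x s - x t) /\<^sub>R (s - t)) \<longlongrightarrow> v) (at t)"
    by (metis Lim_null tendsto_norm_zero_cancel)
  then show "((\<lambda>s. (x s - x t) /\<^sub>R (s - t)) \<longlongrightarrow> v) (at_right t)"
    by (rule tendsto_within_subset) simp
  show "eventually (\<lambda>s. (x s - x t) /\<^sub>R (s - t) \<in> C) (at_right t)"
    using eventually_at_right_real[of t "t + e"] assms by (auto elim: eventually_mono)
qed (use assms in auto)

text \<open>Explicit Euler polygons with step \<open>1 / Suc k\<close>, where the field is evaluated at a nearby point of \<open>G\<close>.\<close>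

locale euler_scheme =
  fixes F :: "'a::euclidean_space \<Rightarrow> 'a" and A :: real and G :: "'a set"
    and x0 :: 'a and u y :: "nat \<Rightarrow> nat \<Rightarrow> 'a"
  assumes A: "0 \<le> A" and growth: "\<And>y. norm (F y) \<le> A * (1 + norm y)"
    and u_0: "\<And>k. u k 0 = x0"
    and u_Suc: "\<And>k n. u k (Suc n) = u k n + F (y k n) /\<^sub>R Suc k"
    and y_G: "\<And>k n. y k n \<in> G"
    and y_near: "\<And>k n. norm (y k n - u k n) \<le> 1 / Suc k"
begin

definition speed :: "real \<Rightarrow> real" where "speed T = A * (exp (A * T) * (2 + norm x0))"

lemma speed_nonneg: "0 \<le> speed T" using A by (simp add: speed_def)

lemma norm_field: "norm (F (y k n)) \<le> A * (2 + norm (u k n))"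
proof -
  have "norm (y k n) \<le> norm (u k n) + 1 / Suc k"
    using y_near[of k n] norm_triangle_sub[of "y k n" "u k n"] by simp
  also have "1 / real (Suc k) \<le> 1" by simp
  finally have "1 + norm (y k n) \<le> 2 + norm (u k n)" by simp
  then show ?thesis using growth[of "y k n"] A by (meson mult_left_mono order_trans)
qed

lemma norm_u: "2 + norm (u k n) \<le> exp (A * n / Suc k) * (2 + norm x0)"
proof (induction n)
  case 0 then show ?case by (simp add: u_0)
next
  case (Suc n)
  have "2 + norm (u k (Suc n)) \<le> 2 + norm (u k n) + norm (F (y k n)) / Suc k"
    unfolding u_Suc using norm_triangle_ineq[of "u k n" "F (y k n) /\<^sub>R Suc k"] by (simp add: divide_inverse_commute)
  also have "\<dots> \<le> 2 + norm (u k n) + A * (2 + norm (u k n)) / Suc k"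
    using norm_field[of k n] by (simp add: divide_right_mono)
  also have "\<dots> = (1 + A / Suc k) * (2 + norm (u k n))" by (simp add: field_simps)
  also have "\<dots> \<le> exp (A / Suc k) * (exp (A * n / Suc k) * (2 + norm x0))"
    using A Suc by (intro mult_mono) (auto intro: add_nonneg_nonneg)
  also have "\<dots> = exp (A * Suc n / Suc k) * (2 + norm x0)"
  proof -
    have "A * Suc n / Suc k = A / Suc k + A * n / Suc k"
      by (simp add: add_divide_distrib[symmetric] distrib_left)
    then show ?thesis by (simp only: exp_add mult.assoc)
  qed
  finally show ?case .
qed

lemma norm_u_le: 
  assumes "real n \<le> T * real (Suc k)" shows "2 + norm (u k n) \<le> exp (A * T) * (2 + norm x0)"
proof -
  have "A * (real n / Suc k) \<le> A * T" using assms A by (intro mult_left_mono) (auto simp: field_simps)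
  then have "exp (A * n / Suc k) * (2 + norm x0) \<le> exp (A * T) * (2 + norm x0)"
    by (intro mult_right_mono) auto
  then show ?thesis using norm_u[of k n] by simp
qed

lemma norm_field_le: "real n \<le> T * real (Suc k) \<Longrightarrow> norm (F (y k n)) \<le> speed T"
  using norm_field[of k n] norm_u_le[of n T k] A unfolding speed_def by (meson mult_left_mono order_trans)

lemma u_diff: "m \<le> n \<Longrightarrow> u k n - u k m = (\<Sum>q=m..<n. F (y k q)) /\<^sub>R Suc k"
proof (induction n rule: nat_induct_at_least)
  case (Suc n)
  then show ?case by (simp add: u_Suc scaleR_add_right algebra_simps)
qed simp

lemma norm_u_diff:
  assumes "m \<le> n" "real n \<le> T * real (Suc k)"
  shows "norm (u k n - u k m) \<le> speed T * (real n - real m) / Suc k"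
proof -
  have "norm (\<Sum>q=m..<n. F (y k q)) \<le> of_nat (card {m..<n}) * speed T"
    using assms by (intro sum_norm_bound norm_field_le) auto
  then have "norm (\<Sum>q=m..<n. F (y k q)) / Suc k \<le> speed T * (real n - real m) / Suc k"
    using assms(1) by (intro divide_right_mono) (auto simp: of_nat_diff mult.commute)
  then show ?thesis unfolding u_diff[OF assms(1)] by (simp add: divide_inverse_commute)
qed

definition idx :: "nat \<Rightarrow> real \<Rightarrow> nat" where "idx k t = nat \<lfloor>t * Suc k\<rfloor>"

lemma idx_bounds:
  assumes "0 \<le> (t::real)" shows "real (idx k t) \<le> t * Suc k" "t * Suc k < real (idx k t) + 1"
  using assms unfolding idx_def by (simp_all add: of_nat_nat floor_correct del: of_nat_Suc)

lemma idx_mono: "s \<le> t \<Longrightarrow> idx k s \<le> idx k t"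
  unfolding idx_def by (intro nat_mono floor_mono mult_right_mono) auto

lemma idx_tendsto:
  assumes "0 \<le> (t::real)" shows "(\<lambda>k. idx k t / Suc k) \<longlonglongrightarrow> t"
proof (rule LIMSEQ_I)
  fix r :: real assume "0 < r"
  then obtain n where n: "inverse (Suc n) < r" using reals_Archimedean by blast
  have "norm (idx k t / Suc k - t) < r" if "n \<le> k" for k
  proof -
    have "\<bar>real (idx k t) - t * Suc k\<bar> < 1" using idx_bounds[OF assms, of k] by (simp add: abs_less_iff del: of_nat_Suc)
    then have "\<bar>(real (idx k t) - t * Suc k) / Suc k\<bar> < 1 / Suc k" by (simp add: divide_strict_right_mono del: of_nat_Suc)
    also have "1 / real (Suc k) \<le> inverse (Suc n)" using that by (simp add: field_simps)
    finally show ?thesis using n by (simp add: diff_divide_distrib del: of_nat_Suc)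
  qed
  then show "\<exists>no. \<forall>k\<ge>no. norm (idx k t / Suc k - t) < r" by blast
qed

lemma step_limit:
  obtains \<F> x where "\<F> \<noteq> bot" "\<F> \<le> sequentially" "\<And>t. 0 \<le> t \<Longrightarrow> ((\<lambda>k. u k (idx k t)) \<longlongrightarrow> x t) \<F>"
proof -
  have "norm (u k (idx k (max 0 t))) \<le> exp (A * max 0 t) * (2 + norm x0)" for k t
    using norm_u_le[OF idx_bounds(1)[of "max 0 t" k]] by simp
  then obtain \<F> x where "\<F> \<noteq> bot" "\<F> \<le> sequentially" "\<And>t. ((\<lambda>k. u k (idx k (max 0 t))) \<longlongrightarrow> x t) \<F>"
    using pointwise_convergent_subfilter[of "\<lambda>k t. u k (idx k (max 0 t))" "\<lambda>t. exp (A * max 0 t) * (2 + norm x0)"] by blast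
  then show thesis using that[of \<F> x] by (metis max_absorb2)
qed

context
  fixes \<F> x
  assumes nb: "\<F> \<noteq> bot" and sq: "\<F> \<le> sequentially"
    and lim: "\<And>t. 0 \<le> t \<Longrightarrow> ((\<lambda>k. u k (idx k t)) \<longlongrightarrow> x t) \<F>"
begin

lemma inverse_Suc_tendsto: "((\<lambda>k. 1 / Suc k) \<longlongrightarrow> 0) \<F>"
  using tendsto_mono[OF sq LIMSEQ_inverse_real_of_nat] by (simp add: inverse_eq_divide)

lemma limit_0: "x 0 = x0"
  using lim[of 0] nb by (simp add: idx_def u_0 tendsto_const_iff)

lemma limit_lipschitz: "(speed T)-lipschitz_on {0..T} x"
proof (rule lipschitz_on_leI)
  fix s t assume st: "s \<in> {0..T}" "t \<in> {0..T}" "s \<le> t"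
  have "norm (x t - x s) \<le> speed T * (t - s)"
  proof (rule tendsto_le[OF nb])
    show "((\<lambda>k. norm (u k (idx k t) - u k (idx k s))) \<longlongrightarrow> norm (x t - x s)) \<F>"
      using st by (intro tendsto_intros lim) auto
    show "((\<lambda>k. speed T * (idx k t / Suc k - idx k s / Suc k)) \<longlongrightarrow> speed T * (t - s)) \<F>"
      using st by (intro tendsto_intros tendsto_mono[OF sq idx_tendsto]) auto
    have "norm (u k (idx k t) - u k (idx k s)) \<le> speed T * (idx k t / Suc k - idx k s / Suc k)" for k
    proof -
      have "real (idx k t) \<le> t * Suc k" using st by (intro idx_bounds) auto
      also have "\<dots> \<le> T * Suc k" using st by (intro mult_right_mono) auto
      finally show ?thesis using norm_u_diff[of "idx k s" "idx k t" T k] idx_mono[OF st(3), of k] by (simp add: diff_divide_distrib algebra_simps)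
    qed
    then show "\<forall>\<^sub>F k in \<F>. norm (u k (idx k t) - u k (idx k s)) \<le> speed T * (idx k t / Suc k - idx k s / Suc k)" by simp
  qed
  then show "dist (x s) (x t) \<le> speed T * dist s t" using st by (simp add: dist_norm norm_minus_commute)
qed (rule speed_nonneg)

lemma limit_quotient:
  assumes st: "0 \<le> t" "t < s" and d: "speed s * (s - t) < d"
  shows "(x s - x t) /\<^sub>R (s - t) \<in> closure (convex hull (F ` (ball (x t) d \<inter> G)))" (is "_ \<in> closure ?H")
proof (rule Lim_in_closed_set[OF closed_closure _ nb])
  let ?w = "\<lambda>k. idx k s / Suc k - idx k t / Suc k"
  have w: "(?w \<longlongrightarrow> s - t) \<F>"
    using st by (intro tendsto_intros tendsto_mono[OF sq idx_tendsto]) auto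
  show "((\<lambda>k. (u k (idx k s) - u k (idx k t)) /\<^sub>R ?w k) \<longlongrightarrow> (x s - x t) /\<^sub>R (s - t)) \<F>"
    using st by (intro tendsto_intros lim w) auto
  have "((\<lambda>k. 1 / Suc k + speed s * ?w k + norm (u k (idx k t) - x t)) \<longlongrightarrow> 0 + speed s * (s - t) + norm (x t - x t)) \<F>"
    using st by (intro tendsto_intros lim w inverse_Suc_tendsto) auto
  then have "\<forall>\<^sub>F k in \<F>. 1 / Suc k + speed s * ?w k + norm (u k (idx k t) - x t) < d"
    using d by (auto dest: order_tendstoD)
  moreover have "\<forall>\<^sub>F k in \<F>. 0 < ?w k" using order_tendstoD(1)[OF w, of 0] st by simp
  ultimately show "\<forall>\<^sub>F k in \<F>. (u k (idx k s) - u k (idx k t)) /\<^sub>R ?w k \<in> closure ?H"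
  proof eventually_elim
    case (elim k)
    define m n where "m = idx k t" "n = idx k s"
    have mn: "m < n" using elim(2) by (simp add: m_n_def diff_divide_distrib[symmetric] zero_less_divide_iff)
    have n: "real n \<le> s * Suc k" unfolding m_n_def using st by (intro idx_bounds) auto
    have "(u k n - u k m) /\<^sub>R ?w k = (\<Sum>q=m..<n. (1 / (real n - real m)) *\<^sub>R F (y k q))"
    proof -
      have "?w k = (real n - real m) / Suc k" by (simp add: m_n_def diff_divide_distrib)
      then have "(u k n - u k m) /\<^sub>R ?w k = (inverse ((real n - real m) / Suc k) * inverse (Suc k)) *\<^sub>R (\<Sum>q=m..<n. F (y k q))"
        using u_diff[of m n k] mn by simp
      also have "inverse ((real n - real m) / Suc k) * inverse (Suc k) = 1 / (real n - real m)"
        by (simp add: inverse_eq_divide)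
      finally show ?thesis by (simp add: scaleR_sum_right)
    qed
    also have "\<dots> \<in> ?H"
    proof (rule convex_sum)
      show "(\<Sum>q=m..<n. 1 / (real n - real m)) = 1" using mn by (simp add: of_nat_diff)
      fix q assume q: "q \<in> {m..<n}"
      have "norm (u k q - u k m) \<le> speed s * (real q - real m) / Suc k"
        using q n by (intro norm_u_diff) auto
      also have "\<dots> \<le> speed s * (real n - real m) / Suc k"
        using q speed_nonneg by (intro divide_right_mono mult_left_mono) auto
      also have "\<dots> = speed s * ?w k" by (simp add: m_n_def diff_divide_distrib right_diff_distrib)
      finally have "norm (y k q - u k q) + norm (u k q - u k m) + norm (u k m - x t) < d"
        using elim(1) y_near[of k q] by (simp add: m_n_def)
      moreover have "norm (y k q - x t) \<le> norm (y k q - u k q) + norm (u k q - u k m) + norm (u k m - x t)"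
        using norm_triangle_ineq[of "y k q - u k q" "u k q - x t"] norm_triangle_ineq[of "u k q - u k m" "u k m - x t"] by simp
      ultimately have "y k q \<in> ball (x t) d" by (simp add: dist_norm norm_minus_commute)
      then show "F (y k q) \<in> ?H" using y_G by (intro hull_inc) auto
    qed (use mn in auto)
    finally show ?case using closure_subset unfolding m_n_def by blast
  qed
qed

lemma limit_derivative:
  assumes v: "(x has_vector_derivative v) (at t)" and t: "0 \<le> t" and d: "0 < d"
  shows "v \<in> closure (convex hull (F ` (ball (x t) d \<inter> G)))"
proof -
  let ?L = "speed (t + 1) + 1"
  have L: "0 < ?L" using speed_nonneg[of "t + 1"] by simp
  show ?thesis
  proof (rule has_vector_derivative_in_closed[OF v closed_closure, of "min 1 (d / ?L)"])
    fix s assume s: "t < s" "s < t + min 1 (d / ?L)"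
    have "A * s \<le> A * (t + 1)" using s A by (intro mult_left_mono) auto
    then have "speed s \<le> speed (t + 1)" unfolding speed_def using A by (intro mult_left_mono mult_right_mono) auto
    then have "speed s * (s - t) \<le> ?L * (s - t)" using s by (intro mult_right_mono) auto
    also have "s - t < d / ?L" using s by simp
    then have "?L * (s - t) < d" using L by (simp add: pos_less_divide_eq mult.commute)
    finally show "(x s - x t) /\<^sub>R (s - t) \<in> closure (convex hull (F ` (ball (x t) d \<inter> G)))"
      using limit_quotient[OF t s(1)] by blast
  qed (use d L in auto)
qed

end

end

section \<open>Generic configurations\<close>

definition generic_set :: "((real^2)^'n::finite) set" where
  "generic_set = - (switching_set \<union> degenerate_set)"

definition switching_at :: "'n \<times> 'n \<times> 'n \<Rightarrow> ((real^2)^'n::finite) set" where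
  "switching_at = (\<lambda>(i, j, k). {x. norm (x$i - x$j) = norm (x$i - x$k)})"

definition degenerate_at :: "'n \<times> 'n \<Rightarrow> ((real^2)^'n::finite) set" where
  "degenerate_at = (\<lambda>(i, j). {x. x$i = x$j})"

lemma switching_set_eq: "switching_set = \<Union>(switching_at ` {(i, j, k). j \<noteq> k \<and> j \<noteq> i \<and> k \<noteq> i})"
  unfolding switching_set_def switching_at_def by auto

lemma degenerate_set_eq: "degenerate_set = \<Union>(degenerate_at ` {(i, j). i \<noteq> j})"
  unfolding degenerate_set_def degenerate_at_def by auto

lemma closed_switching_at: "closed (switching_at p)"
  unfolding switching_at_def by (cases p) (auto intro!: closed_Collect_eq continuous_intros)

lemma closed_degenerate_at: "closed (degenerate_at p)"
  unfolding degenerate_at_def by (cases p) (auto intro!: closed_Collect_eq continuous_intros)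

lemma open_generic_set: "open generic_set"
  unfolding generic_set_def switching_set_eq degenerate_set_eq
  by (intro open_Compl closed_Un closed_UN closed_switching_at closed_degenerate_at ballI) auto

lemma interior_Union_empty:
  assumes "finite \<A>" "\<And>A. A \<in> \<A> \<Longrightarrow> closed A \<and> interior A = {}"
  shows "interior (\<Union>\<A>) = {}"
  using assms by (induction \<A>) (auto simp: interior_closed_Un_empty_interior)

lemma displace_agent:
  fixes x :: "(real^2)^'n::finite"
  assumes "0 < e" "ball x e \<subseteq> A"
  obtains w where "w \<noteq> 0" "x + axis j w \<in> A" "x - axis j w \<in> A" "x \<in> A"
proof
  let ?w = "(e / 2) *\<^sub>R axis 1 1 :: real^2"
  have "norm (axis j ?w :: (real^2)^'n) = norm ?w" by (simp only: norm_eq_sqrt_inner inner_axis_axis) simp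
  then have n: "norm (axis j ?w :: (real^2)^'n) = e / 2" using assms(1) by (simp add: norm_axis_1)
  show "?w \<noteq> 0" using assms(1) by (simp add: axis_eq_0_iff)
  show "x + axis j ?w \<in> A" "x - axis j ?w \<in> A" "x \<in> A"
    using n assms by (auto simp: subset_iff dist_norm)
qed

lemma interior_switching_at:
  assumes "j \<noteq> k" "j \<noteq> i" "k \<noteq> i" shows "interior (switching_at (i, j, k)) = {}"
proof (rule ccontr)
  assume "interior (switching_at (i, j, k)) \<noteq> {}"
  then obtain x e where xe: "0 < e" "ball x e \<subseteq> switching_at (i, j, k)" by (auto simp: mem_interior)
  obtain w where w: "w \<noteq> 0" "x + axis j w \<in> switching_at (i, j, k)" "x - axis j w \<in> switching_at (i, j, k)"
    "x \<in> switching_at (i, j, k)"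
    by (rule displace_agent[OF xe])
  define a where "a = x$i - x$j"
  have "norm (a - w) = norm (x$i - x$k)" "norm (a + w) = norm (x$i - x$k)" "norm a = norm (x$i - x$k)"
    using w(2-) assms by (auto simp: switching_at_def a_def axis_def algebra_simps)
  \<comment> \<open>contradicts the parallelogram law\<close>
  then have "norm (a - w) ^ 2 + norm (a + w) ^ 2 = 2 * norm a ^ 2" by simp
  then have "w \<bullet> w = 0" by (simp add: power2_norm_eq_inner algebra_simps inner_commute)
  with w(1) show False by simp
qed

lemma interior_degenerate_at:
  assumes "i \<noteq> j" shows "interior (degenerate_at (i, j)) = {}"
proof (rule ccontr)
  assume "interior (degenerate_at (i, j)) \<noteq> {}"
  then obtain x e where xe: "0 < e" "ball x e \<subseteq> degenerate_at (i, j)" by (auto simp: mem_interior)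
  obtain w where "w \<noteq> 0" "x + axis j w \<in> degenerate_at (i, j)" "x \<in> degenerate_at (i, j)"
    by (rule displace_agent[OF xe])
  with assms show False by (simp add: degenerate_at_def axis_def)
qed

lemma generic_set_dense:
  fixes x :: "(real^2)^'n::finite"
  assumes "0 < e" obtains y where "y \<in> generic_set" "norm (y - x) \<le> e"
proof -
  have "interior (\<Union>(switching_at ` {(i, j, k). j \<noteq> k \<and> j \<noteq> i \<and> k \<noteq> i} \<union> degenerate_at ` {(i, j). i \<noteq> j})) = {}"
    by (rule interior_Union_empty)
       (auto simp: closed_switching_at closed_degenerate_at interior_switching_at interior_degenerate_at)
  then have "interior (switching_set \<union> degenerate_set) = {}"
    by (simp add: switching_set_eq degenerate_set_eq)
  then have "\<not> ball x e \<subseteq> switching_set \<union> degenerate_set"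
    using assms by (metis mem_interior empty_iff)
  then obtain y where "y \<in> ball x e" "y \<notin> switching_set" "y \<notin> degenerate_set" by blast
  then have "y \<in> ball x e" "y \<in> generic_set" by (auto simp: generic_set_def)
  then show thesis by (intro that[of y]) (auto simp: dist_norm norm_minus_commute)
qed

lemma closest_eqI:
  assumes "j \<noteq> i" "\<And>k. k \<noteq> i \<Longrightarrow> k \<noteq> j \<Longrightarrow> norm (x$i - x$j) < norm (x$i - x$k)"
  shows "closest x i = j"
  unfolding closest_def
proof (rule the_equality)
  fix j' assume j': "j' \<noteq> i \<and> (\<forall>k. k \<noteq> i \<and> k \<noteq> j' \<longrightarrow> norm (x$i - x$j') < norm (x$i - x$k))"
  show "j' = j"
  proof (rule ccontr)
    assume "j' \<noteq> j"
    then have "norm (x$i - x$j') < norm (x$i - x$j)" "norm (x$i - x$j) < norm (x$i - x$j')"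
      using j' assms by auto
    then show False by simp
  qed
qed (use assms in blast)

lemma closest_generic:
  fixes y :: "(real^2)^'n::finite"
  assumes N: "CARD('n) \<ge> 2" and y: "y \<in> generic_set"
  shows "closest y i \<noteq> i"
    and "\<And>k. k \<noteq> i \<Longrightarrow> k \<noteq> closest y i \<Longrightarrow> norm (y$i - y$closest y i) < norm (y$i - y$k)"
proof -
  have "card (UNIV - {i}) \<noteq> 0" using N by (simp add: card_Diff_singleton)
  then have ne: "UNIV - {i} \<noteq> {}" by (metis card.empty)
  let ?S = "(\<lambda>k. norm (y$i - y$k)) ` (UNIV - {i})"
  have "Min ?S \<in> ?S" using ne by (intro Min_in) auto
  then obtain j where "j \<noteq> i" "Min ?S = norm (y$i - y$j)" by auto
  then have j: "j \<noteq> i" "\<And>k. k \<noteq> i \<Longrightarrow> norm (y$i - y$j) \<le> norm (y$i - y$k)"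
    using Min_le[of ?S] by auto
  have lt: "norm (y$i - y$j) < norm (y$i - y$k)" if "k \<noteq> i" "k \<noteq> j" for k
  proof -
    have "y \<in> switching_set" if "norm (y$i - y$j) = norm (y$i - y$k)"
      unfolding switching_set_def using that \<open>k \<noteq> i\<close> \<open>k \<noteq> j\<close> j(1)
      by (intro CollectI exI[of _ i] exI[of _ j] exI[of _ k]) auto
    then have "norm (y$i - y$j) \<noteq> norm (y$i - y$k)" using y by (auto simp: generic_set_def)
    with j(2)[of k] that show ?thesis by simp
  qed
  then have "closest y i = j" using j(1) by (intro closest_eqI) auto
  then show "closest y i \<noteq> i" "\<And>k. k \<noteq> i \<Longrightarrow> k \<noteq> closest y i \<Longrightarrow> norm (y$i - y$closest y i) < norm (y$i - y$k)"
    using j(1) lt by auto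
qed

lemma isCont_nn_field:
  fixes y :: "(real^2)^'n::finite"
  assumes N: "CARD('n) \<ge> 2" and y: "y \<in> generic_set"
  shows "isCont (nn_field \<xi>) y"
proof -
  define c where "c = closest y"
  define F where "F z = (\<chi> i. (z$c i - z$i) - (\<xi>^2 / (norm (z$c i - z$i))^2) *\<^sub>R (z$c i - z$i))" for z :: "(real^2)^'n"
  define W where "W = (\<Inter>(i, k)\<in>{(i, k). k \<noteq> i \<and> k \<noteq> c i}. {z::(real^2)^'n. norm (z$i - z$c i) < norm (z$i - z$k)})"
  have "open W" unfolding W_def by (intro open_INT) (auto intro!: open_Collect_less continuous_intros)
  moreover have "y \<in> W" unfolding W_def c_def using closest_generic[OF N y] by auto
  moreover have "nn_field \<xi> z = F z" if "z \<in> W" for z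
  proof -
    have "closest z i = c i" for i
      using that closest_generic(1)[OF N y, of i] unfolding W_def c_def by (intro closest_eqI) auto
    then show ?thesis by (simp add: nn_field_def F_def)
  qed
  ultimately have ev: "\<forall>\<^sub>F z in nhds y. nn_field \<xi> z = F z"
    by (auto simp: eventually_nhds)
  have "y$c i \<noteq> y$i" for i
    using y closest_generic(1)[OF N y, of i] unfolding generic_set_def degenerate_set_def c_def by auto
  then have "(F \<longlongrightarrow> F y) (at y)"
    unfolding F_def by (intro tendsto_vec_lambda tendsto_intros) auto
  then have "isCont F y" by (simp add: isCont_def)
  with isCont_cong[OF ev] show ?thesis by simp
qed

lemma filippov_set_nn_field:
  fixes x :: "(real^2)^'n::finite"
  assumes N: "CARD('n) \<ge> 2"
    and v: "\<And>d. 0 < d \<Longrightarrow> v \<in> closure (convex hull (nn_field \<xi> ` (ball x d \<inter> generic_set)))"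
  shows "v \<in> filippov_set (nn_field \<xi>) x"
  unfolding filippov_set_def
proof (intro INT_I, safe)
  fix d :: real and \<Lambda> assume d: "0 < d" and \<Lambda>: "\<Lambda> \<in> null_sets (lebesgue :: ((real^2)^'n) measure)"
  let ?B = "nn_field \<xi> ` (ball x d - \<Lambda> - (switching_set \<union> degenerate_set))"
  have "nn_field \<xi> z \<in> closure ?B" if z: "z \<in> ball x d \<inter> generic_set" for z
  proof (subst closure_approachable, intro allI impI)
    fix e :: real assume "0 < e"
    then obtain r1 where r1: "0 < r1" "\<And>w. dist w z < r1 \<Longrightarrow> dist (nn_field \<xi> w) (nn_field \<xi> z) < e"
      using isCont_nn_field[OF N, of z \<xi>] z unfolding continuous_at_eps_delta by auto
    obtain r2 where r2: "0 < r2" "ball z r2 \<subseteq> ball x d \<inter> generic_set"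
      using z open_generic_set by (meson open_Int open_ball openE)
    have "\<not> ball z (min r1 r2) \<subseteq> \<Lambda>"
    proof
      assume "ball z (min r1 r2) \<subseteq> \<Lambda>"
      then have "negligible (ball z (min r1 r2))"
        using \<Lambda> negligible_subset negligible_iff_null_sets by blast
      then show False using open_not_negligible[of "ball z (min r1 r2)"] r1 r2 by auto
    qed
    then obtain w where "w \<in> ball z (min r1 r2)" "w \<notin> \<Lambda>" by blast
    then have w: "dist w z < r1" "w \<in> ball z r2" "w \<notin> \<Lambda>" by (auto simp: dist_commute)
    then have "w \<in> ball x d - \<Lambda> - (switching_set \<union> degenerate_set)"
      using r2 by (auto simp: generic_set_def)
    then show "\<exists>b\<in>?B. dist b (nn_field \<xi> z) < e" using r1(2)[OF w(1)] by blast
  qed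
  then have "nn_field \<xi> ` (ball x d \<inter> generic_set) \<subseteq> closure (convex hull ?B)"
    using closure_mono[OF hull_subset] by blast
  then have "convex hull (nn_field \<xi> ` (ball x d \<inter> generic_set)) \<subseteq> closure (convex hull ?B)"
    by (intro hull_minimal convex_closure convex_convex_hull) auto
  then have "closure (convex hull (nn_field \<xi> ` (ball x d \<inter> generic_set))) \<subseteq> closure (convex hull ?B)"
    by (intro closure_minimal) auto
  then show "v \<in> closure (convex hull ?B)" using v[OF d] by blast
qed

section \<open>Diameters of clusters\<close>

text \<open>Truncating the repulsion at distance \<open>m\<close> makes the field grow at most linearly.\<close>

definition trunc_field :: "real \<Rightarrow> real \<Rightarrow> (real^2)^'n::finite \<Rightarrow> (real^2)^'n" where
  "trunc_field \<xi> m y = (\<chi> i. (\<xi>^2 / (max m (norm (y$closest y i - y$i)))^2 - 1) *\<^sub>R (y$i - y$closest y i))"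

lemma trunc_field_eq_nn_field:
  fixes y :: "(real^2)^'n::finite"
  assumes "CARD('n) \<ge> 2" "y \<in> generic_set" "\<And>i j. i \<noteq> j \<Longrightarrow> m \<le> norm (y$i - y$j)"
  shows "trunc_field \<xi> m y = nn_field \<xi> y"
proof -
  have "m \<le> norm (y$closest y i - y$i)" for i
    using assms closest_generic(1)[OF assms(1,2), of i] by blast
  then show ?thesis unfolding trunc_field_def nn_field_def
    by (simp add: vec_eq_iff max_absorb2 algebra_simps)
qed

lemma norm_trunc_field_component:
  assumes "0 < m" shows "norm (trunc_field \<xi> m y $ i) \<le> 2 * norm y + \<xi>^2 / m"
proof -
  define d where "d = norm (y$closest y i - y$i)"
  have "norm (trunc_field \<xi> m y $ i) = \<bar>\<xi>^2 / (max m d)^2 - 1\<bar> * d"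
    by (simp add: trunc_field_def d_def norm_minus_commute)
  also have "\<dots> \<le> (\<xi>^2 / (max m d)^2 + 1) * d"
    unfolding d_def by (intro mult_right_mono) (auto simp: abs_le_iff)
  also have "\<dots> = d + \<xi>^2 * (d / (max m d)^2)" by (simp add: algebra_simps)
  also have "d / (max m d)^2 \<le> 1 / m"
  proof -
    have "d * m \<le> max m d * max m d" using assms unfolding d_def by (intro mult_mono) auto
    then show ?thesis using assms by (simp add: field_simps power2_eq_square less_max_iff_disj)
  qed
  also have "d \<le> 2 * norm y"
    unfolding d_def using norm_triangle_ineq4[of "y$closest y i" "y$i"] Finite_Cartesian_Product.norm_nth_le[of y i] Finite_Cartesian_Product.norm_nth_le[of y "closest y i"]
    by linarith
  finally show ?thesis by (simp add: mult_left_mono)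
qed

lemma norm_trunc_field:
  fixes y :: "(real^2)^'n::finite"
  assumes "0 < m" shows "norm (trunc_field \<xi> m y) \<le> CARD('n) * (2 + \<xi>^2 / m) * (1 + norm y)"
proof -
  have "norm (trunc_field \<xi> m y) \<le> (\<Sum>i\<in>UNIV. norm (trunc_field \<xi> m y $ i))"
    by (simp add: norm_vec_def L2_set_le_sum)
  also have "\<dots> \<le> CARD('n) * (2 * norm y + \<xi>^2 / m)"
    by (intro sum_bounded_above norm_trunc_field_component assms)
  also have "\<dots> \<le> CARD('n) * ((2 + \<xi>^2 / m) * (1 + norm y))"
  proof -
    define r where "r = \<xi>^2 / m"
    have "0 \<le> r * norm y" using assms by (simp add: r_def)
    then have "2 * norm y + r \<le> (2 + r) * (1 + norm y)" by (simp add: algebra_simps)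
    then show ?thesis unfolding r_def by (intro mult_left_mono) auto
  qed
  finally show ?thesis by simp
qed

lemma component_diff_near:
  fixes u y :: "(real^2)^'n::finite"
  assumes "norm (y - u) \<le> h"
  shows "norm ((y$a - y$b) - (u$a - u$b)) \<le> 2 * h"
proof -
  have "norm ((y$a - y$b) - (u$a - u$b)) = norm ((y - u)$a - (y - u)$b)" by (simp add: algebra_simps)
  also have "\<dots> \<le> norm ((y - u)$a) + norm ((y - u)$b)" by (rule norm_triangle_ineq4)
  also have "\<dots> \<le> 2 * h" using Finite_Cartesian_Product.norm_nth_le[of "y - u" a] Finite_Cartesian_Product.norm_nth_le[of "y - u" b] assms by linarith
  finally show ?thesis .
qed

text \<open>An agent \<open>a\<close> at an end of a diameter of an isolated cluster is pushed away from some point of the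
  cluster, and the cluster lies in the half plane behind \<open>a\<close>.\<close>

lemma trunc_field_outward:
  fixes u y :: "(real^2)^'n::finite"
  assumes N: "CARD('n) \<ge> 2" and y: "y \<in> generic_set" "norm (y - u) \<le> h"
    and m: "0 < m" "m \<le> \<xi>" and ab: "a \<in> I" "b \<in> I" "a \<noteq> b"
    and diam: "\<And>p q. p \<in> I \<Longrightarrow> q \<in> I \<Longrightarrow> norm (u$p - u$q) \<le> norm (u$a - u$b)"
    and isolated: "\<And>l. l \<notin> I \<Longrightarrow> norm (u$a - u$b) + 4 * h < norm (u$a - u$l)"
    and small: "norm (u$a - u$b) + 2 * h \<le> \<xi>"
  shows "- (2 * (\<xi>^2 / m^2) * h * norm (u$a - u$b)) \<le> (u$a - u$b) \<bullet> trunc_field \<xi> m y $ a"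
proof -
  define c where "c = closest y a"
  define D where "D = norm (u$a - u$b)"
  have h: "0 \<le> h" using y(2) norm_ge_zero order_trans by blast
  have yu: "norm (u$p - u$q) - 2 * h \<le> norm (y$p - y$q)" "norm (y$p - y$q) \<le> norm (u$p - u$q) + 2 * h" for p q
    using component_diff_near[OF y(2), of p q] norm_triangle_ineq2[of "y$p - y$q" "u$p - u$q"]
      norm_triangle_ineq3[of "y$p - y$q" "u$p - u$q"] by linarith+
  have c: "c \<noteq> a" "\<And>k. k \<noteq> a \<Longrightarrow> k \<noteq> c \<Longrightarrow> norm (y$a - y$c) < norm (y$a - y$k)"
    using closest_generic[OF N y(1)] unfolding c_def by auto
  have "c \<in> I"
  proof (rule ccontr)
    assume "c \<notin> I"
    then have "norm (y$a - y$c) < norm (y$a - y$b)" using c(2)[of b] ab by auto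
    moreover have "D + 2 * h < norm (y$a - y$c)" using isolated[OF \<open>c \<notin> I\<close>] yu(1)[of a c] by (simp add: D_def)
    ultimately show False using yu(2)[of a b] by (simp add: D_def)
  qed
  define d where "d = norm (y$c - y$a)"
  define \<kappa> where "\<kappa> = \<xi>^2 / (max m d)^2 - 1"
  have "d \<le> \<xi>" using yu(2)[of a c] diam[OF ab(1) \<open>c \<in> I\<close>] small by (simp add: d_def norm_minus_commute)
  then have "(max m d)^2 \<le> \<xi>^2" using m by (intro power_mono) auto
  moreover have "m^2 \<le> (max m d)^2" "0 < m^2" using m by (auto intro: power_mono)
  moreover from this have "0 < (max m d)^2" by linarith
  ultimately have \<kappa>: "0 \<le> \<kappa>" "\<kappa> \<le> \<xi>^2 / m^2"
    using frac_le[of "\<xi>^2" "\<xi>^2" "m^2" "(max m d)^2"] le_divide_eq_1_pos[of "(max m d)^2" "\<xi>^2"]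
    unfolding \<kappa>_def by linarith+
  have "0 \<le> (u$a - u$b) \<bullet> (u$a - u$c)"
  proof -
    have "norm (u$c - u$b)^2 \<le> norm (u$a - u$b)^2"
      by (intro power_mono diam \<open>c \<in> I\<close> ab) auto
    then have "0 \<le> 2 * ((u$a - u$b) \<bullet> (u$a - u$c)) - norm (u$a - u$c)^2"
      by (simp add: power2_norm_eq_inner algebra_simps inner_commute)
    then show ?thesis using zero_le_power2[of "norm (u$a - u$c)"] by linarith
  qed
  moreover have "- (D * (2 * h)) \<le> (u$a - u$b) \<bullet> ((y$a - y$c) - (u$a - u$c))"
  proof -
    have "\<bar>(u$a - u$b) \<bullet> ((y$a - y$c) - (u$a - u$c))\<bar> \<le> D * norm ((y$a - y$c) - (u$a - u$c))"
      unfolding D_def by (rule Cauchy_Schwarz_ineq2)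
    also have "\<dots> \<le> D * (2 * h)"
      using component_diff_near[OF y(2)] by (intro mult_left_mono) (auto simp: D_def)
    finally show ?thesis by linarith
  qed
  ultimately have "- (D * (2 * h)) \<le> (u$a - u$b) \<bullet> (y$a - y$c)"
    by (simp add: inner_diff_right)
  then have "\<kappa> * (- (D * (2 * h))) \<le> \<kappa> * ((u$a - u$b) \<bullet> (y$a - y$c))" using \<kappa> by (intro mult_left_mono)
  then have "- (\<kappa> * (D * (2 * h))) \<le> \<kappa> * ((u$a - u$b) \<bullet> (y$a - y$c))" by simp
  also have "\<kappa> * ((u$a - u$b) \<bullet> (y$a - y$c)) = (u$a - u$b) \<bullet> trunc_field \<xi> m y $ a"
    by (simp add: trunc_field_def \<kappa>_def d_def c_def)
  finally have "- (\<kappa> * (D * (2 * h))) \<le> (u$a - u$b) \<bullet> trunc_field \<xi> m y $ a" .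
  moreover have "- (\<xi>^2 / m^2 * (D * (2 * h))) \<le> - (\<kappa> * (D * (2 * h)))"
    using \<kappa> h by (intro le_imp_neg_le mult_right_mono) (auto simp: D_def)
  ultimately have "- (\<xi>^2 / m^2 * (D * (2 * h))) \<le> (u$a - u$b) \<bullet> trunc_field \<xi> m y $ a"
    by (rule order_trans[rotated])
  then show ?thesis by (simp add: D_def mult_ac)
qed

lemma euler_step_diameter:
  fixes u y :: "(real^2)^'n::finite"
  assumes N: "CARD('n) \<ge> 2" and y: "y \<in> generic_set" "norm (y - u) \<le> h"
    and m: "0 < m" "m \<le> \<xi>" and ab: "a \<in> I" "b \<in> I" "u$a \<noteq> u$b"
    and diam: "\<And>p q. p \<in> I \<Longrightarrow> q \<in> I \<Longrightarrow> norm (u$p - u$q) \<le> norm (u$a - u$b)"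
    and isolated: "\<And>p l. p \<in> I \<Longrightarrow> l \<notin> I \<Longrightarrow> norm (u$a - u$b) + 4 * h < norm (u$p - u$l)"
    and small: "norm (u$a - u$b) + 2 * h \<le> \<xi>"
    and u': "u' = u + h *\<^sub>R trunc_field \<xi> m y"
  shows "norm (u$a - u$b) - 4 * (\<xi>^2 / m^2) * h^2 \<le> norm (u'$a - u'$b)"
proof -
  define D where "D = norm (u$a - u$b)"
  define K where "K = \<xi>^2 / m^2"
  define f where "f = trunc_field \<xi> m y"
  have D: "0 < D" using ab by (simp add: D_def)
  have h: "0 \<le> h" using y(2) norm_ge_zero order_trans by blast
  have ne: "a \<noteq> b" using ab by auto
  have 1: "- (2 * K * h * D) \<le> (u$a - u$b) \<bullet> f $ a"
    unfolding K_def D_def f_def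
    by (rule trunc_field_outward[OF N y m ab(1,2) ne diam isolated[OF ab(1)] small])
  have 2: "- (2 * K * h * D) \<le> (u$b - u$a) \<bullet> f $ b"
    unfolding K_def D_def f_def norm_minus_commute[of "u$a" "u$b"]
    by (rule trunc_field_outward[OF N y m ab(2,1) ne[symmetric]])
       (use diam isolated ab(2) small in \<open>auto simp: norm_minus_commute[of "u$b" "u$a"]\<close>)
  have "(u$a - u$b) \<bullet> (u'$a - u'$b) = D^2 + h * ((u$a - u$b) \<bullet> f $ a + (u$b - u$a) \<bullet> f $ b)"
    unfolding u' D_def f_def power2_norm_eq_inner by (simp add: algebra_simps inner_commute)
  moreover have "h * (- (2 * K * h * D) + - (2 * K * h * D)) \<le> h * ((u$a - u$b) \<bullet> f $ a + (u$b - u$a) \<bullet> f $ b)"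
    using 1 2 h by (intro mult_left_mono add_mono)
  ultimately have "D * (D - 4 * K * h^2) \<le> (u$a - u$b) \<bullet> (u'$a - u'$b)"
    by (simp add: algebra_simps power2_eq_square)
  also have "\<dots> \<le> D * norm (u'$a - u'$b)" unfolding D_def by (rule norm_cauchy_schwarz)
  finally show ?thesis using D by (simp add: D_def K_def)
qed

lemma finite_max_pair:
  fixes g :: "'b \<Rightarrow> 'b \<Rightarrow> real"
  assumes "finite I" "I \<noteq> {}"
  shows "\<exists>a\<in>I. \<exists>b\<in>I. \<forall>p\<in>I. \<forall>q\<in>I. g p q \<le> g a b"
proof -
  let ?S = "case_prod g ` (I \<times> I)"
  have "Max ?S \<in> ?S" using assms by (intro Max_in) auto
  then obtain a b where ab: "a \<in> I" "b \<in> I" "Max ?S = g a b" by auto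
  have "g p q \<le> g a b" if "p \<in> I" "q \<in> I" for p q
    using that assms ab(3) Max_ge[of ?S "g p q"] by auto
  with ab show ?thesis by blast
qed

text \<open>A cluster of \<open>k\<close> agents whose diameter drops below \<open>\<beta> * 4 ^ k\<close> is isolated, since otherwise
  one more agent would form a cluster of diameter below \<open>\<beta> * 4 ^ (k + 1)\<close>.\<close>

lemma cluster_diameter_bound:
  fixes u y :: "nat \<Rightarrow> (real^2)^'n::finite"
  assumes N: "CARD('n) \<ge> 2" and \<beta>: "0 < \<beta>" "\<beta> * 4 ^ CARD('n) + \<beta> \<le> \<xi>"
    and init: "\<And>i j. i \<noteq> j \<Longrightarrow> \<beta> * 4 ^ CARD('n) \<le> norm (u 0 $ i - u 0 $ j)"
    and step: "\<And>n. u (Suc n) = u n + h *\<^sub>R trunc_field \<xi> \<beta> (y n)"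
    and y: "\<And>n. y n \<in> generic_set" "\<And>n. norm (y n - u n) \<le> h"
    and L: "\<And>n. n \<le> M \<Longrightarrow> norm (trunc_field \<xi> \<beta> (y n)) \<le> L"
    and small: "4 * h + 2 * h * L + 4 * (\<xi>^2 / \<beta>^2) * M * h^2 \<le> \<beta>"
  shows "n \<le> M \<Longrightarrow> 2 \<le> card I \<Longrightarrow>
    \<exists>i\<in>I. \<exists>j\<in>I. \<beta> * 4 ^ card I - 2 * h * L - 4 * (\<xi>^2 / \<beta>^2) * n * h^2 \<le> norm (u n $ i - u n $ j)"
proof (induction n arbitrary: I)
  case 0
  have h: "0 \<le> h" using y(2)[of 0] norm_ge_zero order_trans by blast
  have "0 \<le> L" using L[of 0] norm_ge_zero order_trans by blast
  then have hL: "0 \<le> h * L" using h by simp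
  obtain i j where ij: "i \<in> I" "j \<in> I" "i \<noteq> j"
    using 0(2) by (metis card_2_iff' card_le_Suc0_iff_eq finite not_less_eq_eq numeral_2_eq_2)
  have "\<beta> * 4 ^ card I \<le> \<beta> * 4 ^ CARD('n)"
    using \<beta>(1) by (intro mult_left_mono power_increasing card_mono) auto
  also have "\<dots> \<le> norm (u 0 $ i - u 0 $ j)" using init ij by blast
  finally show ?case using ij hL by (intro bexI[of _ i] bexI[of _ j]) auto
next
  case (Suc n)
  define K where "K = \<xi>^2 / \<beta>^2"
  define \<eta> where "\<eta> = 2 * h * L + 4 * K * n * h^2"
  have h: "0 \<le> h" using y(2)[of 0] norm_ge_zero order_trans by blast
  have L0: "0 \<le> L" using L[of 0] norm_ge_zero order_trans by blast
  have hL: "0 \<le> h * L" using h L0 by simp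
  have K: "0 \<le> K" by (simp add: K_def)
  have "K * h^2 * real n \<le> K * h^2 * real M" using Suc.prems(1) K by (intro mult_left_mono) auto
  then have "4 * K * n * h^2 \<le> 4 * K * M * h^2" by (simp add: mult_ac)
  then have \<eta>: "4 * h + \<eta> \<le> \<beta>" using small unfolding \<eta>_def K_def by linarith
  have IH: "\<exists>i\<in>J. \<exists>j\<in>J. \<beta> * 4 ^ card J - \<eta> \<le> norm (u n $ i - u n $ j)" if "2 \<le> card J" for J
    using Suc.IH[OF _ that] Suc.prems(1) by (simp add: \<eta>_def K_def diff_diff_eq)
  have "I \<noteq> {}" using Suc.prems by auto
  obtain a b where ab: "a \<in> I" "b \<in> I"
    and max: "\<forall>p\<in>I. \<forall>q\<in>I. norm (u n $ p - u n $ q) \<le> norm (u n $ a - u n $ b)"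
    using finite_max_pair[OF finite \<open>I \<noteq> {}\<close>, of "\<lambda>p q. norm (u n $ p - u n $ q)"] by blast
  note ab = ab max[rule_format]
  define D where "D = norm (u n $ a - u n $ b)"
  have DIH: "\<beta> * 4 ^ card I - \<eta> \<le> D" using IH[OF Suc.prems(2)] ab(3) unfolding D_def by (meson order_trans)
  have pow: "16 * \<beta> \<le> \<beta> * 4 ^ card I"
    using power_increasing[OF Suc.prems(2), of "4::real"] \<beta>(1) by simp
  have "\<beta> * 4 ^ card I - 2 * h * L - 4 * K * Suc n * h^2 \<le> norm (u (Suc n) $ a - u (Suc n) $ b)"
  proof (cases "\<beta> * 4 ^ card I \<le> D")
    case True
    define f where "f = trunc_field \<xi> \<beta> (y n)"
    have "norm (f$a) \<le> L" "norm (f$b) \<le> L"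
      using Finite_Cartesian_Product.norm_nth_le[of f a] Finite_Cartesian_Product.norm_nth_le[of f b] L[of n] Suc.prems(1) by (auto simp: f_def)
    then have "norm (f$a - f$b) \<le> 2 * L" using norm_triangle_ineq4[of "f$a" "f$b"] by linarith
    then have fL: "norm (h *\<^sub>R (f$a - f$b)) \<le> h * (2 * L)" using h by (simp add: mult_left_mono)
    have "u (Suc n) $ a - u (Suc n) $ b = (u n $ a - u n $ b) + h *\<^sub>R (f$a - f$b)"
      by (simp add: step f_def algebra_simps)
    then have "D - h * (2 * L) \<le> norm (u (Suc n) $ a - u (Suc n) $ b)"
      using fL norm_diff_ineq[of "u n $ a - u n $ b" "h *\<^sub>R (f$a - f$b)"] by (simp add: D_def)
    moreover have "0 \<le> 4 * K * Suc n * h^2" using K by simp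
    ultimately show ?thesis using True by linarith
  next
    case False
    have "D - 4 * K * h^2 \<le> norm (u (Suc n) $ a - u (Suc n) $ b)"
      unfolding D_def K_def
    proof (rule euler_step_diameter[OF N y \<beta>(1) _ ab(1,2) _ ab(3)])
      have "0 \<le> \<beta> * 4 ^ CARD('n)" using \<beta>(1) by simp
      then show "\<beta> \<le> \<xi>" using \<beta>(2) by linarith
      have "0 < D" using DIH pow \<eta> \<beta>(1) h by linarith
      then show "u n $ a \<noteq> u n $ b" by (auto simp: D_def)
      have "\<beta> * 4 ^ card I \<le> \<beta> * 4 ^ CARD('n)"
        using \<beta>(1) by (intro mult_left_mono power_increasing card_mono) auto
      moreover have "0 \<le> 4 * K * n * h^2" using K by simp
      then have "0 \<le> \<eta>" using hL unfolding \<eta>_def by linarith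
      ultimately show "norm (u n $ a - u n $ b) + 2 * h \<le> \<xi>"
        using False \<eta> h \<beta> unfolding D_def by linarith
      show "norm (u n $ a - u n $ b) + 4 * h < norm (u n $ p - u n $ l)" if pl: "p \<in> I" "l \<notin> I" for p l
      proof (rule ccontr)
        assume "\<not> ?thesis"
        then have near: "norm (u n $ p - u n $ l) \<le> D + 4 * h" by (simp add: D_def)
        have l: "norm (u n $ l - u n $ q) \<le> 2 * D + 4 * h" if "q \<in> I" for q
          using norm_triangle_ineq[of "u n $ l - u n $ p" "u n $ p - u n $ q"] near ab(3)[OF pl(1) that]
          by (simp add: norm_minus_commute D_def)
        have D0: "0 \<le> D" by (simp add: D_def)
        have all: "norm (u n $ r - u n $ q) \<le> 2 * D + 4 * h" if rq: "r \<in> insert l I" "q \<in> insert l I" for r q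
        proof -
          consider "r = l" "q = l" | "r = l" "q \<in> I" | "q = l" "r \<in> I" | "r \<in> I" "q \<in> I" using rq by blast
          then show ?thesis
          proof cases
            case 4
            then show ?thesis using ab(3)[of r q] D0 h unfolding D_def by linarith
          qed (use l l[unfolded norm_minus_commute[of "u n $ l"]] D0 h in auto)
        qed
        have card: "card (insert l I) = Suc (card I)" using pl by simp
        obtain r q where "r \<in> insert l I" "q \<in> insert l I" "\<beta> * 4 ^ Suc (card I) - \<eta> \<le> norm (u n $ r - u n $ q)"
          using IH[of "insert l I", unfolded card] Suc.prems(2) le_SucI by blast
        then have "\<beta> * 4 ^ Suc (card I) - \<eta> \<le> 2 * D + 4 * h" using all by (meson order_trans)
        then show False using False pow \<eta> \<beta>(1) by simp
      qed
    qed (simp_all add: step)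
    then show ?thesis using DIH by (simp add: \<eta>_def algebra_simps)
  qed
  then show ?case using ab unfolding K_def by blast
qed

lemma pair_distance_bound:
  fixes u y :: "nat \<Rightarrow> (real^2)^'n::finite"
  assumes "CARD('n) \<ge> 2" "0 < \<beta>" "\<beta> * 4 ^ CARD('n) + \<beta> \<le> \<xi>"
    and "\<And>i j. i \<noteq> j \<Longrightarrow> \<beta> * 4 ^ CARD('n) \<le> norm (u 0 $ i - u 0 $ j)"
    and "\<And>n. u (Suc n) = u n + h *\<^sub>R trunc_field \<xi> \<beta> (y n)"
    and y: "\<And>n. y n \<in> generic_set" "\<And>n. norm (y n - u n) \<le> h"
    and "\<And>n. n \<le> M \<Longrightarrow> norm (trunc_field \<xi> \<beta> (y n)) \<le> L"
    and small: "4 * h + 2 * h * L + 4 * (\<xi>^2 / \<beta>^2) * M * h^2 \<le> \<beta>"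
    and "i \<noteq> j"
  shows "15 * \<beta> \<le> norm (u M $ i - u M $ j)"
proof -
  have h: "0 \<le> h" using y(2)[of 0] norm_ge_zero order_trans by blast
  have "\<exists>a\<in>{i, j}. \<exists>b\<in>{i, j}. \<beta> * 4 ^ card {i, j} - 2 * h * L - 4 * (\<xi>^2 / \<beta>^2) * M * h^2 \<le> norm (u M $ a - u M $ b)"
    by (rule cluster_diameter_bound[OF assms(1-9)]) (use assms in auto)
  moreover have "\<beta> * 4 ^ card {i, j} = 16 * \<beta>" using \<open>i \<noteq> j\<close> by simp
  ultimately obtain a b where ab: "a \<in> {i, j}" "b \<in> {i, j}" "16 * \<beta> - 2 * h * L - 4 * (\<xi>^2 / \<beta>^2) * M * h^2 \<le> norm (u M $ a - u M $ b)"
    by metis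
  then have "15 * \<beta> \<le> norm (u M $ a - u M $ b)" using small h by linarith
  with ab(1,2) \<open>0 < \<beta>\<close> show ?thesis by (auto simp: norm_minus_commute)
qed

section \<open>Existence of a solution without collisions\<close>

lemma lipschitz_imp_abs_continuous_on:
  assumes "L-lipschitz_on {a..b} g"
  shows "abs_continuous_on a b g"
  unfolding abs_continuous_on_def
proof (intro allI impI)
  fix \<epsilon> :: real assume \<epsilon>: "0 < \<epsilon>"
  have L: "0 \<le> L" using assms by (rule lipschitz_on_nonneg)
  have "(\<Sum>k<n. norm (g (v k) - g (u k))) < \<epsilon>"
    if uv: "\<forall>k<n. a \<le> u k \<and> u k \<le> v k \<and> v k \<le> b" and sm: "(\<Sum>k<n. v k - u k) < \<epsilon> / (L + 1)" for n :: nat and u v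
  proof -
    have "norm (g (v k) - g (u k)) \<le> L * (v k - u k)" if "k < n" for k
    proof -
      have "u k \<in> {a..b}" "v k \<in> {a..b}" "u k \<le> v k" using uv that by (auto intro: order_trans)
      then show ?thesis using lipschitz_onD[OF assms, of "v k" "u k"] by (simp add: dist_norm)
    qed
    then have "(\<Sum>k<n. norm (g (v k) - g (u k))) \<le> L * (\<Sum>k<n. v k - u k)"
      unfolding sum_distrib_left by (intro sum_mono) auto
    also have "\<dots> \<le> (L + 1) * (\<Sum>k<n. v k - u k)"
      using uv by (intro mult_right_mono sum_nonneg) auto
    also have "\<dots> < \<epsilon>" using sm L by (simp add: pos_less_divide_eq mult.commute)
    finally show ?thesis .
  qed
  then show "\<exists>\<delta>>0. \<forall>(n::nat) u v. (\<forall>k<n. a \<le> u k \<and> u k \<le> v k \<and> v k \<le> b) \<and>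
      (\<forall>k<n. \<forall>l<n. k \<noteq> l \<longrightarrow> v k \<le> u l \<or> v l \<le> u k) \<and> (\<Sum>k<n. v k - u k) < \<delta> \<longrightarrow>
      (\<Sum>k<n. norm (g (v k) - g (u k))) < \<epsilon>"
    using \<epsilon> L by (intro exI[of _ "\<epsilon> / (L + 1)"]) auto
qed

lemma euler_scheme_exists:
  fixes x0 :: "(real^2)^'n::finite"
  assumes "0 < m"
  obtains u y where "euler_scheme (trunc_field \<xi> m) (CARD('n) * (2 + \<xi>^2 / m)) generic_set x0 u y"
proof -
  have "\<forall>x e. \<exists>y. 0 < e \<longrightarrow> y \<in> generic_set \<and> norm (y - (x :: (real^2)^'n)) \<le> e"
    using generic_set_dense by metis
  then obtain pick :: "(real^2)^'n \<Rightarrow> real \<Rightarrow> (real^2)^'n" where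
    pick: "\<And>x e. 0 < e \<Longrightarrow> pick x e \<in> generic_set \<and> norm (pick x e - x) \<le> e" by metis
  define u where "u k = rec_nat x0 (\<lambda>_ x. x + trunc_field \<xi> m (pick x (1 / Suc k)) /\<^sub>R Suc k)" for k :: nat
  define y where "y k n = pick (u k n) (1 / Suc k)" for k n :: nat
  show thesis
  proof (rule that, unfold_locales)
    show "0 \<le> CARD('n) * (2 + \<xi>^2 / m)" using assms by simp
    show "norm (trunc_field \<xi> m z) \<le> CARD('n) * (2 + \<xi>^2 / m) * (1 + norm z)" for z :: "(real^2)^'n"
      by (rule norm_trunc_field[OF assms])
    show "u k 0 = x0" "u k (Suc n) = u k n + trunc_field \<xi> m (y k n) /\<^sub>R Suc k" for k n
      by (simp_all add: u_def y_def)
    show "y k n \<in> generic_set" "norm (y k n - u k n) \<le> 1 / Suc k" for k n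
      using pick[of "1 / Suc k" "u k n"] by (simp_all add: y_def)
  qed
qed

lemma nondegenerate_separated:
  fixes x :: "(real^2)^'n::finite"
  assumes "x \<notin> degenerate_set"
  shows "\<exists>d>0. \<forall>i j. i \<noteq> j \<longrightarrow> d \<le> norm (x$i - x$j)"
proof (intro exI conjI allI impI)
  let ?S = "insert 1 ((\<lambda>(i, j). norm (x$i - x$j)) ` {(i, j). i \<noteq> j})"
  show "0 < Min ?S" using assms by (subst Min_gr_iff) (auto simp: degenerate_set_def)
  show "Min ?S \<le> norm (x$i - x$j)" if "i \<noteq> j" for i j
    using that by (intro Min_le) auto
qed

theorem mainTheorem1:
  fixes \<xi> :: real and x0 :: "(real^2)^'n::finite"
  assumes "CARD('n) \<ge> 2" and "\<xi> > 0" and "x0 \<notin> degenerate_set"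
  shows "\<exists>x. filippov_solution (nn_field \<xi>) x \<and> x 0 = x0 \<and>
           (\<forall>t>0. x t \<notin> degenerate_set)"
proof -
  obtain d where d: "0 < d" "\<And>i j. i \<noteq> j \<Longrightarrow> d \<le> norm (x0$i - x0$j)"
    using nondegenerate_separated[OF assms(3)] by blast
  define \<beta> where "\<beta> = min d \<xi> / 2 / 4 ^ CARD('n)"
  have \<beta>0: "0 < \<beta>" using d assms(2) by (simp add: \<beta>_def)
  have \<beta>N: "\<beta> * 4 ^ CARD('n) = min d \<xi> / 2" by (simp add: \<beta>_def)
  have "\<beta> \<le> \<beta> * 4 ^ CARD('n)" using \<beta>0 by simp
  then have \<beta>: "\<beta> * 4 ^ CARD('n) + \<beta> \<le> \<xi>" "\<beta> * 4 ^ CARD('n) \<le> d"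
    using \<beta>N d(1) assms(2) by auto
  obtain u y where "euler_scheme (trunc_field \<xi> \<beta>) (CARD('n) * (2 + \<xi>^2 / \<beta>)) generic_set x0 u y"
    using euler_scheme_exists[OF \<beta>0] .
  then interpret euler_scheme "trunc_field \<xi> \<beta>" "CARD('n) * (2 + \<xi>^2 / \<beta>)" generic_set x0 u y .
  obtain \<F> x where lim: "\<F> \<noteq> bot" "\<F> \<le> sequentially"
    "\<And>t. 0 \<le> t \<Longrightarrow> ((\<lambda>k. u k (idx k t)) \<longlongrightarrow> x t) \<F>"
    using step_limit by blast
  have sep: "15 * \<beta> \<le> norm (x t $ i - x t $ j)" if t: "0 \<le> t" and ij: "i \<noteq> j" for t i j
  proof (rule tendsto_lowerbound[OF _ _ lim(1)])
    show "((\<lambda>k. norm (u k (idx k t) $ i - u k (idx k t) $ j)) \<longlongrightarrow> norm (x t $ i - x t $ j)) \<F>"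
      by (intro tendsto_intros lim(3) t)
    let ?c = "4 + 2 * speed t + 4 * (\<xi>^2 / \<beta>^2) * t"
    have "((\<lambda>k. 1 / Suc k * ?c) \<longlongrightarrow> 0 * ?c) \<F>"
      by (intro tendsto_mult inverse_Suc_tendsto[OF lim] tendsto_const)
    then have "\<forall>\<^sub>F k in \<F>. 1 / Suc k * ?c < \<beta>" using \<beta>0 by (auto dest: order_tendstoD)
    then show "\<forall>\<^sub>F k in \<F>. 15 * \<beta> \<le> norm (u k (idx k t) $ i - u k (idx k t) $ j)"
    proof eventually_elim
      case (elim k)
      define h where "h = 1 / real (Suc k)"
      have h: "0 < h" by (simp add: h_def)
      have M: "real (idx k t) * h \<le> t" using idx_bounds(1)[OF t, of k] by (simp add: h_def field_simps)
      show ?case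
      proof (rule pair_distance_bound[OF assms(1) \<beta>0 \<beta>(1)])
        show "\<beta> * 4 ^ CARD('n) \<le> norm (u k 0 $ i - u k 0 $ j)" if "i \<noteq> j" for i j
          using d(2)[OF that] \<beta>(2) by (simp add: u_0)
        show "u k (Suc n) = u k n + h *\<^sub>R trunc_field \<xi> \<beta> (y k n)" for n
          by (simp add: u_Suc h_def inverse_eq_divide)
        show "y k n \<in> generic_set" "norm (y k n - u k n) \<le> h" for n
          using y_G y_near by (auto simp: h_def)
        show "norm (trunc_field \<xi> \<beta> (y k n)) \<le> speed t" if "n \<le> idx k t" for n
          using that idx_bounds(1)[OF t, of k] by (intro norm_field_le) linarith
        have "4 * (\<xi>^2 / \<beta>^2) * h * (real (idx k t) * h) \<le> 4 * (\<xi>^2 / \<beta>^2) * h * t"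
          using M h by (intro mult_left_mono) auto
        moreover have "h * ?c < \<beta>" using elim by (simp add: h_def)
        ultimately show "4 * h + 2 * h * speed t + 4 * (\<xi>^2 / \<beta>^2) * real (idx k t) * h^2 \<le> \<beta>"
          by (simp add: algebra_simps power2_eq_square)
      qed (rule ij)
    qed
  qed
  have deg: "x t \<notin> degenerate_set" if "0 \<le> t" for t
    using sep[OF that] \<beta>0 unfolding degenerate_set_def by fastforce
  have fil: "v \<in> filippov_set (nn_field \<xi>) (x t)" if t: "0 < t" and v: "(x has_vector_derivative v) (at t)" for t v
  proof (rule filippov_set_nn_field[OF assms(1)])
    fix \<delta> :: real assume \<delta>: "0 < \<delta>"
    have "trunc_field \<xi> \<beta> z = nn_field \<xi> z" if z: "z \<in> ball (x t) (min \<delta> \<beta>) \<inter> generic_set" for z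
    proof (rule trunc_field_eq_nn_field[OF assms(1)])
      fix i j :: 'n assume "i \<noteq> j"
      have "norm (z - x t) \<le> \<beta>" using z by (simp add: dist_norm norm_minus_commute)
      then have "norm ((z$i - z$j) - (x t $ i - x t $ j)) \<le> 2 * \<beta>" by (rule component_diff_near)
      then show "\<beta> \<le> norm (z$i - z$j)"
        using sep[OF less_imp_le[OF t] \<open>i \<noteq> j\<close>] \<beta>0 norm_triangle_ineq3[of "z$i - z$j" "x t $ i - x t $ j"] by linarith
    qed (use z in auto)
    then have "trunc_field \<xi> \<beta> ` (ball (x t) (min \<delta> \<beta>) \<inter> generic_set) \<subseteq> nn_field \<xi> ` (ball (x t) \<delta> \<inter> generic_set)"
      by auto
    moreover have "v \<in> closure (convex hull (trunc_field \<xi> \<beta> ` (ball (x t) (min \<delta> \<beta>) \<inter> generic_set)))"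
      by (rule limit_derivative[OF lim v]) (use t \<delta> \<beta>0 in auto)
    ultimately show "v \<in> closure (convex hull (nn_field \<xi> ` (ball (x t) \<delta> \<inter> generic_set)))"
      using closure_mono[OF hull_mono] by blast
  qed
  have "AE t in lborel. 0 < t \<longrightarrow> x differentiable at t"
    by (rule locally_lipschitz_differentiable_AE[OF limit_lipschitz[OF lim]])
  then have "AE t in lborel. 0 < t \<longrightarrow> (\<exists>v. (x has_vector_derivative v) (at t) \<and> v \<in> filippov_set (nn_field \<xi>) (x t))"
  proof eventually_elim
    case (elim t)
    then show ?case using fil by (auto simp: vector_derivative_works)
  qed
  then have "filippov_solution (nn_field \<xi>) x"
    unfolding filippov_solution_def using lipschitz_imp_abs_continuous_on[OF limit_lipschitz[OF lim]] by blast
  with limit_0[OF lim] deg show ?thesis by auto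
qed

end
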